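(* Let $G$ be a graph, a directed graph, or more generally a binary structure. If there is an ordering $\sigma: v_1,\ldots,v_n$ of its domain such that the matrix $A_\sigma(G)$ is $k$-mixed free, then $\mathrm{tww}(G)=2^{2^{O(k)}}$.
   Context: A binary structure is a finite domain $D$ with binary relations $E^1,\ldots,E^h$ (a graph or digraph is the case $h=1$). For an ordering $v_1,\ldots,v_n$ of $D$, $A_\sigma(G)$ is the $n\times n$ matrix whose $(i,j)$ entry is $(e_1,\ldots,e_h)$ where $e_p=2$ if $(v_i,v_j)\in E^p$ and $(v_j,v_i)\in E^p$, $e_p=1$ if only $(v_i,v_j)\in E^p$, $e_p=-1$ if only $(v_j,v_i)\in E^p$, and $e_p=0$ otherwise. Two disjoint subsets $X,Y\subseteq D$ are homogeneous if for every $p$ and all $x,x'\in X$, $y,y'\in Y$: $(x,y)\in E^p\iff(x',y')\in E^p$ and $(y,x)\in E^p\iff(y',x')\in E^p$. The twin-width $\mathrm{tww}(G)$ is the least $d$ such that there is a sequence of partitions of $D$ from the partition into singletons to $\{D\}$, each obtained from the previous by merging two parts, in which every part $X$ of every partition is non-homogeneous with at most $d$ other parts. A matrix $(m_{i,j})$ is vertical if $m_{i,j}=m_{i+1,j}$ for all $i,j$, horizontal if $m_{i,j}=m_{i,j+1}$ for all $i,j$, and mixed if neither; a $k$-mixed minor is a partition of the rows into $k$ sets of consecutive rows and of the columns into $k$ sets of consecutive columns such that every one of the $k^2$ resulting submatrices is mixed; a matrix is $k$-mixed free if it has no $k$-mixed minor. *)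

theory Defs
  imports
    "HOL-Library.Disjoint_Sets"
    "HOL-Library.Landau_Symbols"
    "Jordan_Normal_Form.DL_Submatrix"
begin

section \<open>Binary structures and their matrices\<close>

text \<open>The structure with domain \<open>D\<close> and relations \<open>E\<^sup>1, \<dots>, E\<^sup>h\<close> is given by \<open>D\<close> and the
  list of its \<open>h\<close> relations. Graphs and digraphs are the lists of length one.\<close>

definition binary_structure :: "'a set \<Rightarrow> 'a rel list \<Rightarrow> bool" where
  "binary_structure D Es \<longleftrightarrow> finite D \<and> (\<forall>E\<in>set Es. E \<subseteq> D \<times> D)"

text \<open>An ordering of \<open>D\<close> is a list enumerating \<open>D\<close> without repetitions.\<close>

definition domain_ordering :: "'a set \<Rightarrow> 'a list \<Rightarrow> bool" where
  "domain_ordering D vs \<longleftrightarrow> distinct vs \<and> set vs = D"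

definition pair_code :: "'a rel \<Rightarrow> 'a \<Rightarrow> 'a \<Rightarrow> int" where
  "pair_code E x y =
     (if (x, y) \<in> E \<and> (y, x) \<in> E then 2
      else if (x, y) \<in> E then 1
      else if (y, x) \<in> E then - 1
      else 0)"

text \<open>Rows and columns are numbered from 0; an entry is the list \<open>[e\<^sub>1, \<dots>, e\<^sub>h]\<close>.\<close>

definition ordered_matrix :: "'a rel list \<Rightarrow> 'a list \<Rightarrow> int list mat" where
  "ordered_matrix Es vs =
     mat (length vs) (length vs) (\<lambda>(i, j). map (\<lambda>E. pair_code E (vs ! i) (vs ! j)) Es)"


section \<open>Mixed minors\<close>

definition vertical_mat :: "'b mat \<Rightarrow> bool" where
  "vertical_mat M \<longleftrightarrow>
     (\<forall>i j. Suc i < dim_row M \<and> j < dim_col M \<longrightarrow> M $$ (i, j) = M $$ (Suc i, j))"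

definition horizontal_mat :: "'b mat \<Rightarrow> bool" where
  "horizontal_mat M \<longleftrightarrow>
     (\<forall>i j. i < dim_row M \<and> Suc j < dim_col M \<longrightarrow> M $$ (i, j) = M $$ (i, Suc j))"

definition mixed_mat :: "'b mat \<Rightarrow> bool" where
  "mixed_mat M \<longleftrightarrow> \<not> vertical_mat M \<and> \<not> horizontal_mat M"

definition consecutive_partition :: "nat \<Rightarrow> nat \<Rightarrow> nat set set \<Rightarrow> bool" where
  "consecutive_partition n k P \<longleftrightarrow>
     partition_on {..<n} P \<and> card P = k \<and> (\<forall>I\<in>P. \<exists>a b. I = {a..<b})"

definition is_mixed_minor :: "nat \<Rightarrow> 'b mat \<Rightarrow> nat set set \<Rightarrow> nat set set \<Rightarrow> bool" where
  "is_mixed_minor k M R C \<longleftrightarrow>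
     consecutive_partition (dim_row M) k R \<and> consecutive_partition (dim_col M) k C \<and>
     (\<forall>I\<in>R. \<forall>J\<in>C. mixed_mat (submatrix M I J))"

definition mixed_free :: "nat \<Rightarrow> 'b mat \<Rightarrow> bool" where
  "mixed_free k M \<longleftrightarrow> (\<nexists>R C. is_mixed_minor k M R C)"


section \<open>Twin-width\<close>

definition homogeneous :: "'a rel list \<Rightarrow> 'a set \<Rightarrow> 'a set \<Rightarrow> bool" where
  "homogeneous Es X Y \<longleftrightarrow>
     (\<forall>E\<in>set Es. \<forall>x\<in>X. \<forall>x'\<in>X. \<forall>y\<in>Y. \<forall>y'\<in>Y.
        ((x, y) \<in> E \<longleftrightarrow> (x', y') \<in> E) \<and> ((y, x) \<in> E \<longleftrightarrow> (y', x') \<in> E))"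

definition merges_two_parts :: "'a set set \<Rightarrow> 'a set set \<Rightarrow> bool" where
  "merges_two_parts P Q \<longleftrightarrow>
     (\<exists>X\<in>P. \<exists>Y\<in>P. X \<noteq> Y \<and> Q = insert (X \<union> Y) (P - {X, Y}))"

text \<open>The final partition \<open>{D} - {{}}\<close> is \<open>{D}\<close> unless \<open>D\<close> is empty, in which case it is the
  only partition of the empty set, namely the empty one. So the empty structure has
  twin-width 0.\<close>

definition contraction_sequence :: "'a set \<Rightarrow> 'a set set list \<Rightarrow> bool" where
  "contraction_sequence D Ps \<longleftrightarrow>
     Ps \<noteq> [] \<and> (\<forall>P\<in>set Ps. partition_on D P) \<and>
     hd Ps = (\<lambda>v. {v}) ` D \<and> last Ps = {D} - {{}} \<and>
     successively merges_two_parts Ps"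

definition error_degree :: "'a rel list \<Rightarrow> 'a set set \<Rightarrow> 'a set \<Rightarrow> nat" where
  "error_degree Es P X = card {Y \<in> P. Y \<noteq> X \<and> \<not> homogeneous Es X Y}"

definition has_d_sequence :: "'a set \<Rightarrow> 'a rel list \<Rightarrow> nat \<Rightarrow> bool" where
  "has_d_sequence D Es d \<longleftrightarrow>
     (\<exists>Ps. contraction_sequence D Ps \<and> (\<forall>P\<in>set Ps. \<forall>X\<in>P. error_degree Es P X \<le> d))"

definition twin_width :: "'a set \<Rightarrow> 'a rel list \<Rightarrow> nat" where
  "twin_width D Es = (LEAST d. has_d_sequence D Es d)"

end

theory Submission
  imports Defs "HOL-Library.Infinite_Set"
begin

text \<open>Keep one division of the ordering into intervals, used for rows and columns alike, and bound for
  each part the number of parts and boundaries with which its rows form a corner, that is, a mixed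
  \<open>2 \<times> 2\<close> block of consecutive entries. If merging any two neighbouring parts broke the bound, the
  corners would give a \<open>0/1\<close> matrix with linearly many ones, hence by the Marcus--Tardos theorem (with
  Fox's constant \<open>2\<^sup>O\<^sup>(\<^sup>k\<^sup>)\<close>) a grid minor and so a \<open>k\<close>-mixed minor. Thus all parts can be merged into
  one while the bound \<open>T\<close> persists.

  Within a part, group the vertices whose rows agree outside the mixed zones of that part. A zone
  without corners is vertical or horizontal, so the unmixed columns are determined by \<open>T + 1\<close> of them
  and there are at most \<open>4\<^sup>h\<^sup>(\<^sup>T\<^sup>+\<^sup>1\<^sup>)\<close> groups. Two groups whose parts form an unmixed zone are
  homogeneous, and these partitions get coarser as parts are merged. Any sequence of contractions
  between two consecutive ones therefore has error degree at most \<open>2 T 4\<^sup>h\<^sup>(\<^sup>T\<^sup>+\<^sup>1\<^sup>)\<close>.\<close>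

section \<open>The Marcus--Tardos theorem for grid minors\<close>

text \<open>A point in every cell forces \<open>r i < r (Suc i)\<close> and
  \<open>c j < c (Suc j)\<close>, so \<open>r\<close> and \<open>c\<close> act as increasing cut
  points. The cells are contiguous but may leave out the margins of the matrix.\<close>

definition grid_minor :: "nat \<Rightarrow> (nat \<times> nat) set \<Rightarrow> bool" where
  "grid_minor k A \<longleftrightarrow>
     (\<exists>r c. \<forall>i<k. \<forall>j<k. \<exists>x y. (x, y) \<in> A \<and> r i \<le> x \<and> x < r (Suc i) \<and> c j \<le> y \<and> y < c (Suc j))"

lemma grid_minor_converseI:
  assumes "grid_minor k A"
  shows "grid_minor k (A\<inverse>)"
proof -
  obtain r c where "\<forall>i<k. \<forall>j<k. \<exists>x y. (x, y) \<in> A \<and>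
      r i \<le> x \<and> x < r (Suc i) \<and> c j \<le> y \<and> y < c (Suc j)"
    using assms unfolding grid_minor_def by blast
  then have "\<forall>i<k. \<forall>j<k. \<exists>y x. (y, x) \<in> A\<inverse> \<and>
      c i \<le> y \<and> y < c (Suc i) \<and> r j \<le> x \<and> x < r (Suc j)"
    by (simp only: converse_iff) blast
  then show ?thesis
    unfolding grid_minor_def by blast
qed

lemma grid_minor_converse: "grid_minor k (A\<inverse>) \<longleftrightarrow> grid_minor k A"
  using grid_minor_converseI[of k A] grid_minor_converseI[of k "A\<inverse>"] by auto

text \<open>Multiplying the row cuts by \<open>s\<close> pulls the minor back:
  \<open>t \<le> x div s\<close> iff \<open>t * s \<le> x\<close>, and \<open>x div s < t\<close>
  iff \<open>x < t * s\<close>.\<close>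

lemma grid_minor_contract_rows:
  assumes "grid_minor k ((\<lambda>(x, y). (x div s, y)) ` A)" "s > 0"
  shows "grid_minor k A"
proof -
  obtain r c where rc: "\<forall>i<k. \<forall>j<k. \<exists>x y. (x, y) \<in> (\<lambda>(x, y). (x div s, y)) ` A \<and>
      r i \<le> x \<and> x < r (Suc i) \<and> c j \<le> y \<and> y < c (Suc j)"
    using assms(1) unfolding grid_minor_def by blast
  have "\<exists>x y. (x, y) \<in> A \<and> r i * s \<le> x \<and> x < r (Suc i) * s \<and> c j \<le> y \<and> y < c (Suc j)"
    if ij: "i < k" "j < k" for i j
  proof -
    obtain x y where "(x, y) \<in> A" "r i \<le> x div s" "x div s < r (Suc i)" "c j \<le> y" "y < c (Suc j)"
      using rc[rule_format, OF ij] by auto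
    then show ?thesis
      using \<open>s > 0\<close> by (metis less_eq_div_iff_mult_less_eq div_less_iff_less_mult)
  qed
  then show ?thesis
    unfolding grid_minor_def by (intro exI[of _ "\<lambda>i. r i * s"] exI[of _ c]) simp
qed

lemma grid_minor_contract_cols:
  assumes "grid_minor k ((\<lambda>(x, y). (x, y div s)) ` A)" "s > 0"
  shows "grid_minor k A"
proof -
  have "((\<lambda>(x, y). (x, y div s)) ` A)\<inverse> = (\<lambda>(x, y). (x div s, y)) ` (A\<inverse>)"
    by force
  then show ?thesis
    using grid_minor_contract_rows[of k s "A\<inverse>"] assms by (metis grid_minor_converse)
qed

lemma grid_minor_contract:
  assumes "grid_minor k ((\<lambda>(x, y). (x div s, y div s)) ` A)" "s > 0"
  shows "grid_minor k A"
proof -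
  have "(\<lambda>(x, y). (x div s, y div s)) ` A = (\<lambda>(x, y). (x div s, y)) ` (\<lambda>(x, y). (x, y div s)) ` A"
    by (force simp: image_image)
  then show ?thesis
    using assms grid_minor_contract_rows grid_minor_contract_cols by metis
qed

lemma four_classes_pigeonhole:
  assumes "finite I" "I \<subseteq> I1 \<union> I2 \<union> I3 \<union> I4"
    and "I1 \<subseteq> I" "I2 \<subseteq> I" "I3 \<subseteq> I" "I4 \<subseteq> I"
  obtains "card I \<le> 4 * card I1" | "card I \<le> 4 * card I2"
    | "card I \<le> 4 * card I3" | "card I \<le> 4 * card I4"
proof -
  have "finite (I1 \<union> I2 \<union> I3 \<union> I4)"
    by (rule finite_subset[OF _ assms(1)]) (intro Un_least assms)
  then have "card I \<le> card (I1 \<union> I2 \<union> I3 \<union> I4)"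
    by (rule card_mono) (rule assms(2))
  also have "\<dots> \<le> card I1 + card I2 + card I3 + card I4"
    using card_Un_le[of "I1 \<union> I2 \<union> I3" I4] card_Un_le[of "I1 \<union> I2" I3] card_Un_le[of I1 I2]
    by linarith
  finally show thesis using that by linarith
qed

text \<open>Fox's halving argument. Descend into the fuller half of a dyadic interval; whenever the other
  half is nonempty as well, it becomes an interval of its own, so that \<open>2 ^ m\<close> points yield
  \<open>m + 1\<close> intervals. Each step has four outcomes, hence the factor \<open>4 ^ L\<close>.\<close>

lemma dyadic_pigeonhole:
  fixes W :: "'i \<Rightarrow> nat set"
  assumes "finite I" "\<And>i. i \<in> I \<Longrightarrow> W i \<subseteq> {a..<a + 2 ^ L} \<and> 2 ^ m \<le> card (W i)"
  shows "\<exists>J c. J \<subseteq> I \<and> card I \<le> 4 ^ L * card J \<and> a \<le> c 0 \<and> c (Suc m) \<le> a + 2 ^ L \<and>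
    (\<forall>i\<in>J. \<forall>l\<le>m. W i \<inter> {c l..<c (Suc l)} \<noteq> {})"
  using assms
proof (induction L arbitrary: a m I W)
  case (0 a m I W)
  show ?case
  proof (cases m)
    case 0
    have "W i \<inter> {a..<Suc a} \<noteq> {}" if "i \<in> I" for i
    proof -
      have "W i \<noteq> {}" using "0.prems"(2)[OF that] by (metis card.empty not_one_le_zero one_le_power order_trans one_le_numeral)
      then show ?thesis using "0.prems"(2)[OF that] by auto
    qed
    then show ?thesis
      using 0 by (intro exI[of _ I] exI[of _ "\<lambda>l. a + l"]) auto
  next
    case (Suc m')
    have "I = {}"
    proof (rule ccontr)
      assume "I \<noteq> {}"
      then obtain i where i: "i \<in> I" by auto
      have "card (W i) \<le> card {a..<a + 2 ^ 0}"
        by (rule card_mono) (use "0.prems"(2)[OF i] in auto)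
      moreover have "(2::nat) \<le> 2 ^ m" using Suc by simp
      ultimately show False using "0.prems"(2)[OF i] by simp
    qed
    then show ?thesis by (intro exI[of _ "{}"] exI[of _ "\<lambda>_. a"]) auto
  qed
next
  case (Suc L a m I W)
  show ?case
  proof (cases m)
    case 0
    have "W i \<inter> {a..<a + 2 ^ Suc L} \<noteq> {}" if "i \<in> I" for i
    proof -
      have "W i \<noteq> {}" using Suc.prems(2)[OF that] 0 by auto
      then show ?thesis using Suc.prems(2)[OF that] by blast
    qed
    then show ?thesis
      using 0 by (intro exI[of _ I] exI[of _ "\<lambda>l. if l = 0 then a else a + 2 ^ Suc L"]) auto
  next
    case m: (Suc m')
    define mid where "mid = a + 2 ^ L"
    have top: "a + 2 ^ Suc L = mid + 2 ^ L" by (simp add: mid_def)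
    define lo where "lo = (\<lambda>i. W i \<inter> {a..<mid})"
    define hi where "hi = (\<lambda>i. W i \<inter> {mid..<mid + 2 ^ L})"
    have W: "W i = lo i \<union> hi i" and finW: "finite (W i)" if "i \<in> I" for i
    proof -
      show "W i = lo i \<union> hi i"
        using Suc.prems(2)[OF that] top unfolding lo_def hi_def by (auto simp: mid_def)
      show "finite (W i)" using Suc.prems(2)[OF that] finite_subset by blast
    qed
    have half: "2 ^ m' \<le> card (lo i) \<or> 2 ^ m' \<le> card (hi i)" if "i \<in> I" for i
    proof -
      have "2 * 2 ^ m' \<le> card (lo i) + card (hi i)"
        using Suc.prems(2)[OF that] W[OF that] card_Un_le[of "lo i" "hi i"] m by simp
      then show ?thesis by linarith
    qed
    \<comment> \<open>Either one half is missed and the window shrinks at no cost, or both are met: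
      then one keeps \<open>2 ^ m'\<close> points for the recursion and the other supplies an extra
      interval.\<close>
    define I1 where "I1 = {i \<in> I. hi i = {}}"
    define I2 where "I2 = {i \<in> I. lo i = {}}"
    define I3 where "I3 = {i \<in> I. hi i \<noteq> {} \<and> 2 ^ m' \<le> card (lo i)}"
    define I4 where "I4 = {i \<in> I. lo i \<noteq> {} \<and> 2 ^ m' \<le> card (hi i)}"
    have sub: "I1 \<subseteq> I" "I2 \<subseteq> I" "I3 \<subseteq> I" "I4 \<subseteq> I"
      by (auto simp: I1_def I2_def I3_def I4_def)
    have "I \<subseteq> I1 \<union> I2 \<union> I3 \<union> I4"
      using half by (auto simp: I1_def I2_def I3_def I4_def)
    then consider "card I \<le> 4 * card I1" | "card I \<le> 4 * card I2"
      | "card I \<le> 4 * card I3" | "card I \<le> 4 * card I4"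
      using four_classes_pigeonhole[OF \<open>finite I\<close>] sub by metis
    then show ?thesis
    proof cases
      case 1
      have "W i \<subseteq> {a..<a + 2 ^ L} \<and> 2 ^ m \<le> card (W i)" if "i \<in> I1" for i
        using that W[of i] Suc.prems(2)[of i] by (auto simp: I1_def lo_def mid_def)
      then obtain J c where "J \<subseteq> I1" "card I1 \<le> 4 ^ L * card J" "a \<le> c 0"
        "c (Suc m) \<le> a + 2 ^ L" "\<forall>i\<in>J. \<forall>l\<le>m. W i \<inter> {c l..<c (Suc l)} \<noteq> {}"
        using Suc.IH[of I1 W a m] finite_subset[OF sub(1) \<open>finite I\<close>] by blast
      then show ?thesis
        using 1 sub by (intro exI[of _ J] exI[of _ c]) auto
    next
      case 2
      have "W i \<subseteq> {mid..<mid + 2 ^ L} \<and> 2 ^ m \<le> card (W i)" if "i \<in> I2" for i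
        using that W[of i] Suc.prems(2)[of i] by (auto simp: I2_def hi_def)
      then obtain J c where "J \<subseteq> I2" "card I2 \<le> 4 ^ L * card J" "mid \<le> c 0"
        "c (Suc m) \<le> mid + 2 ^ L" "\<forall>i\<in>J. \<forall>l\<le>m. W i \<inter> {c l..<c (Suc l)} \<noteq> {}"
        using Suc.IH[of I2 W mid m] finite_subset[OF sub(2) \<open>finite I\<close>] by blast
      then show ?thesis
        using 2 sub top by (intro exI[of _ J] exI[of _ c]) (auto simp: mid_def)
    next
      case 3
      have "lo i \<subseteq> {a..<a + 2 ^ L} \<and> 2 ^ m' \<le> card (lo i)" if "i \<in> I3" for i
        using that by (auto simp: I3_def lo_def mid_def)
      then obtain J c where J: "J \<subseteq> I3" "card I3 \<le> 4 ^ L * card J" and c: "a \<le> c 0"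
        "c (Suc m') \<le> a + 2 ^ L" and hit: "\<forall>i\<in>J. \<forall>l\<le>m'. lo i \<inter> {c l..<c (Suc l)} \<noteq> {}"
        using Suc.IH[of I3 lo a m'] finite_subset[OF sub(3) \<open>finite I\<close>] by blast
      \<comment> \<open>The upper half is appended as the last interval.\<close>
      define c' where "c' = (\<lambda>l. if l \<le> Suc m' then c l else a + 2 ^ Suc L)"
      have "W i \<inter> {c' l..<c' (Suc l)} \<noteq> {}" if "i \<in> J" "l \<le> m" for i l
      proof (cases "l \<le> m'")
        case True
        then show ?thesis using hit that by (fastforce simp: c'_def lo_def)
      next
        case False
        then have "l = Suc m'" using that m by simp
        moreover have "hi i \<noteq> {}" using that J by (auto simp: I3_def)
        ultimately show ?thesis using c top by (auto simp: c'_def hi_def mid_def)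
      qed
      then show ?thesis
        using 3 J sub c m by (intro exI[of _ J] exI[of _ c']) (auto simp: c'_def)
    next
      case 4
      have "hi i \<subseteq> {mid..<mid + 2 ^ L} \<and> 2 ^ m' \<le> card (hi i)" if "i \<in> I4" for i
        using that by (auto simp: I4_def hi_def)
      then obtain J c where J: "J \<subseteq> I4" "card I4 \<le> 4 ^ L * card J" and c: "mid \<le> c 0"
        "c (Suc m') \<le> mid + 2 ^ L" and hit: "\<forall>i\<in>J. \<forall>l\<le>m'. hi i \<inter> {c l..<c (Suc l)} \<noteq> {}"
        using Suc.IH[of I4 hi mid m'] finite_subset[OF sub(4) \<open>finite I\<close>] by blast
      \<comment> \<open>The lower half is prepended as the first interval, shifting the recursive
        cuts by one.\<close>
      define c' where "c' = (\<lambda>l. if l = 0 then a else c (l - 1))"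
      have "W i \<inter> {c' l..<c' (Suc l)} \<noteq> {}" if "i \<in> J" "l \<le> m" for i l
      proof (cases l)
        case 0
        have "lo i \<noteq> {}" using that J by (auto simp: I4_def)
        then show ?thesis using 0 c by (fastforce simp: c'_def lo_def)
      next
        case (Suc l')
        then have "hi i \<inter> {c l'..<c (Suc l')} \<noteq> {}" using hit that m by simp
        then show ?thesis using Suc by (auto simp: c'_def hi_def)
      qed
      then show ?thesis
        using 4 J sub c m top by (intro exI[of _ J] exI[of _ c']) (auto simp: c'_def)
    qed
  qed
qed

text \<open>The window has width \<open>4 ^ Suc m = 2 ^ (2 * Suc m)\<close>, so
  \<open>dyadic_pigeonhole\<close> keeps at least one in \<open>16 ^ Suc m\<close> of the rows.
  Beyond the bound, \<open>Suc m\<close> rows meet the same \<open>Suc m\<close> column intervals,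
  which is a grid minor.\<close>

lemma card_wide_rows_le:
  assumes "finite B" "\<not> grid_minor (Suc m) B"
  shows "card {p. 2 ^ m \<le> card {y. (p, y) \<in> B \<and> y div 4 ^ Suc m = q}} \<le> Suc m * 16 ^ Suc m"
proof (rule ccontr)
  define I where "I = {p. 2 ^ m \<le> card {y. (p, y) \<in> B \<and> y div 4 ^ Suc m = q}}"
  assume "\<not> ?thesis"
  then have big: "Suc m * 16 ^ Suc m < card I" unfolding I_def by simp
  then have "finite I" using card_ge_0_finite by force
  define W where "W = (\<lambda>p. {y. (p, y) \<in> B \<and> y div 4 ^ Suc m = q})"
  have four: "(2::nat) ^ (2 * Suc m) = 4 ^ Suc m" by (simp only: power_mult) simp
  have sixteen: "(4::nat) ^ (2 * Suc m) = 16 ^ Suc m" by (simp only: power_mult) simp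
  have "W i \<subseteq> {q * 4 ^ Suc m..<q * 4 ^ Suc m + 2 ^ (2 * Suc m)} \<and> 2 ^ m \<le> card (W i)"
    if "i \<in> I" for i
  proof -
    have "q * 4 ^ Suc m \<le> y \<and> y < q * 4 ^ Suc m + 4 ^ Suc m" if "y div 4 ^ Suc m = q" for y
    proof -
      have "y = q * 4 ^ Suc m + y mod 4 ^ Suc m" using that by (metis div_mult_mod_eq)
      moreover have "y mod 4 ^ Suc m < 4 ^ Suc m" by simp
      ultimately show ?thesis by linarith
    qed
    then show ?thesis using that unfolding four I_def W_def by auto
  qed
  then obtain J c where J: "J \<subseteq> I" "card I \<le> 4 ^ (2 * Suc m) * card J"
    and hit: "\<And>p l. p \<in> J \<Longrightarrow> l \<le> m \<Longrightarrow> W p \<inter> {c l..<c (Suc l)} \<noteq> {}"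
    using dyadic_pigeonhole[of I W "q * 4 ^ Suc m" "2 * Suc m" m] \<open>finite I\<close> by blast
  note J = J[unfolded sixteen]
  have "16 ^ Suc m * Suc m < 16 ^ Suc m * card J"
    using big J(2) by (simp only: mult.commute[of "Suc m"])
  then have card_J: "Suc m \<le> card J" by (simp only: mult_less_cancel1 less_imp_le)
  have "finite J" using J \<open>finite I\<close> finite_subset by blast
  \<comment> \<open>Each chosen row opens a row interval ending at the next chosen row. The final
    cut is set separately, since \<open>J\<close> may have no element left to enumerate.\<close>
  define r where "r = (\<lambda>i. if i < Suc m then enumerate J i else Suc (enumerate J m))"
  have r: "r i < r (Suc i) \<and> r i \<in> J" if "i < Suc m" for i
    using that card_J \<open>finite J\<close> finite_enumerate_mono[of i "Suc i" J]
    by (auto simp: r_def less_Suc_eq finite_enumerate_in_set)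
  have "\<exists>x y. (x, y) \<in> B \<and> r i \<le> x \<and> x < r (Suc i) \<and> c j \<le> y \<and> y < c (Suc j)"
    if "i < Suc m" "j < Suc m" for i j
    using r[OF that(1)] hit[of "r i" j] that(2) by (fastforce simp: W_def)
  then have "grid_minor (Suc m) B"
    unfolding grid_minor_def by blast
  then show False using assms by simp
qed

text \<open>Contract the matrix to blocks of side \<open>s\<close>. Blocks with at least
  \<open>w\<close> nonempty columns are wide, those with at least \<open>w\<close> nonempty rows
  tall; there are at most \<open>n' * N\<close> of each, with at most \<open>s * s\<close> ones in a
  block. Every other nonempty block has at most \<open>w * w\<close> ones, and the nonempty blocks
  are counted by induction.\<close>

theorem marcus_tardos:
  assumes "A \<subseteq> {..<n} \<times> {..<n}" "\<not> grid_minor (Suc m) A"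
  shows "card A \<le> 8 * Suc m * 64 ^ Suc m * n"
  using assms
proof (induction n arbitrary: A rule: less_induct)
  case (less n A)
  \<comment> \<open>Because \<open>s = 4 * w * w\<close>, the small blocks account for at most half
    of the bound even after rounding up to \<open>n'\<close>; the wide and tall blocks take the
    other half.\<close>
  define s :: nat where "s = 4 ^ Suc m"
  define w :: nat where "w = 2 ^ m"
  define N :: nat where "N = Suc m * 16 ^ Suc m"
  have s: "s = 4 * w * w" "s \<ge> 4"
    by (simp_all add: s_def w_def mult_ac flip: power_mult_distrib)
  have "(64::nat) ^ Suc m = (4 * 16) ^ Suc m" by simp
  also have "\<dots> = 4 ^ Suc m * 16 ^ Suc m" by (rule power_mult_distrib)
  finally have c: "8 * Suc m * 64 ^ Suc m = 8 * s * N"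
    by (simp only: s_def N_def mult_ac)
  have Npos: "N > 0" by (simp add: N_def)
  have finA: "finite A" using less.prems(1) finite_subset by blast
  show ?case
  proof (cases "n < s")
    case True
    have "card A \<le> card ({..<n} \<times> {..<n})"
      by (rule card_mono) (use less.prems in auto)
    also have "\<dots> = n * n" by simp
    also have "\<dots> \<le> (8 * s * N) * n"
    proof (rule mult_right_mono)
      have "n \<le> s * 1" using True by simp
      also have "\<dots> \<le> s * (8 * N)" by (rule mult_le_mono2) (use Npos in simp)
      finally show "n \<le> 8 * s * N" by (simp only: mult_ac)
    qed simp
    finally show ?thesis unfolding c .
  next
    case False
    \<comment> \<open>One more block than \<open>n div s\<close>, for the remainder. Since
      \<open>s \<le> n\<close>, the rounded side \<open>s * n'\<close> is at most
      \<open>2 * n\<close>.\<close>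
    define n' where "n' = Suc (n div s)"
    have sn': "s * n' \<le> 2 * n"
    proof -
      have "s * (n div s) \<le> n" by simp
      then show ?thesis using False unfolding n'_def mult_Suc_right by linarith
    qed
    have "n > 0" using False s(2) by linarith
    moreover have "4 * n' \<le> 2 * n"
      using sn' s(2) by (meson mult_le_mono1 order_trans)
    ultimately have "n' < n" by linarith
    define A' where "A' = (\<lambda>(x, y). (x div s, y div s)) ` A"
    have A'_sub: "A' \<subseteq> {..<n'} \<times> {..<n'}"
      using less.prems(1) by (auto simp: A'_def n'_def div_le_mono less_Suc_eq_le)
    have finA': "finite A'" using finA by (simp add: A'_def)
    have "\<not> grid_minor (Suc m) A'"
      using grid_minor_contract[of "Suc m" s A] less.prems(2) s(2) by (auto simp: A'_def)
    then have IH: "card A' \<le> 8 * s * N * n'"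
      using less.IH[OF \<open>n' < n\<close> A'_sub] unfolding c by blast
    define blk where "blk = (\<lambda>(p, q). {(x, y) \<in> A. x div s = p \<and> y div s = q})"
    \<comment> \<open>With only the rows contracted, row \<open>p\<close> of \<open>B\<close> shows
      which columns of the blocks \<open>(p, q)\<close> are nonempty. \<open>C\<close> does the same
      for the rows of a block, after transposition.\<close>
    define B where "B = (\<lambda>(x, y). (x div s, y)) ` A"
    define C where "C = (\<lambda>(x, y). (x div s, y)) ` (A\<inverse>)"
    have noB: "\<not> grid_minor (Suc m) B" "\<not> grid_minor (Suc m) C"
      using grid_minor_contract_rows[of "Suc m" s A] grid_minor_contract_rows[of "Suc m" s "A\<inverse>"]
        less.prems(2) s(2) by (auto simp: B_def C_def grid_minor_converse)
    define wide where "wide = {(p, q). q < n' \<and> w \<le> card {y. (p, y) \<in> B \<and> y div s = q}}"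
    define tall where "tall = {(p, q). p < n' \<and> w \<le> card {x. (q, x) \<in> C \<and> x div s = p}}"
    have finB: "finite B" "finite C" using finA by (auto simp: B_def C_def)
    have w_pos: "w > 0" by (simp add: w_def)
    have finp: "finite {p. w \<le> card {y. (p, y) \<in> B' \<and> y div s = q}}" if "finite B'" for B' :: "(nat \<times> nat) set" and q
    proof (rule finite_subset)
      show "{p. w \<le> card {y. (p, y) \<in> B' \<and> y div s = q}} \<subseteq> fst ` B'"
      proof
        fix p assume "p \<in> {p. w \<le> card {y. (p, y) \<in> B' \<and> y div s = q}}"
        then have "card {y. (p, y) \<in> B' \<and> y div s = q} \<noteq> 0" using w_pos by simp
        then have "{y. (p, y) \<in> B' \<and> y div s = q} \<noteq> {}" by (metis card.empty)
        then show "p \<in> fst ` B'" by force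
      qed
    qed (use that in simp)
    have wide_eq: "wide = prod.swap ` (SIGMA q:{..<n'}. {p. w \<le> card {y. (p, y) \<in> B \<and> y div s = q}})"
      by (force simp: wide_def)
    have tall_eq: "tall = (SIGMA p:{..<n'}. {q. w \<le> card {x. (q, x) \<in> C \<and> x div s = p}})"
      by (force simp: tall_def)
    have wide_card: "card wide \<le> n' * N" "finite wide"
    proof -
      have "card wide = (\<Sum>q<n'. card {p. w \<le> card {y. (p, y) \<in> B \<and> y div s = q}})"
        unfolding wide_eq using finp[OF finB(1)] by (subst card_image) auto
      also have "\<dots> \<le> (\<Sum>q<n'. N)"
        by (rule sum_mono) (unfold w_def s_def N_def, rule card_wide_rows_le[OF finB(1) noB(1)])
      finally show "card wide \<le> n' * N" by simp
      show "finite wide" unfolding wide_eq using finp[OF finB(1)] by auto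
    qed
    have tall_card: "card tall \<le> n' * N" "finite tall"
    proof -
      have "card tall = (\<Sum>q<n'. card {p. w \<le> card {y. (p, y) \<in> C \<and> y div s = q}})"
        unfolding tall_eq using finp[OF finB(2)] by auto
      also have "\<dots> \<le> (\<Sum>q<n'. N)"
        by (rule sum_mono) (unfold w_def s_def N_def, rule card_wide_rows_le[OF finB(2) noB(2)])
      finally show "card tall \<le> n' * N" by simp
      show "finite tall" unfolding tall_eq using finp[OF finB(2)] by auto
    qed
    have blk_fin: "finite (blk pq)" for pq
      using finA by (auto simp: blk_def intro: finite_subset split: prod.split)
    have blk_big: "card (blk (p, q)) \<le> s * s" for p q
    proof -
      have "blk (p, q) \<subseteq> {p * s..<p * s + s} \<times> {q * s..<q * s + s}"
      proof -
        have "z div s * s \<le> z \<and> z < z div s * s + s" for z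
          using s(2) mod_less_divisor[of s z] div_mult_mod_eq[of z s]
          by (metis add_less_cancel_left div_times_less_eq_dividend gr0I not_numeral_le_zero)
        then show ?thesis by (auto simp: blk_def)
      qed
      then have "card (blk (p, q)) \<le> card ({p * s..<p * s + s} \<times> {q * s..<q * s + s})"
        by (intro card_mono) auto
      then show ?thesis by simp
    qed
    have blk_small: "card (blk (p, q)) \<le> w * w"
      if "(p, q) \<in> A'" "(p, q) \<notin> wide" "(p, q) \<notin> tall" for p q
    proof -
      have pq: "p < n'" "q < n'" using that(1) A'_sub by auto
      let ?Y = "{y. (p, y) \<in> B \<and> y div s = q}" and ?X = "{x. (q, x) \<in> C \<and> x div s = p}"
      have fin: "finite ?X" "finite ?Y"
        by (rule finite_subset[of _ "snd ` C"], force, simp add: finB)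
          (rule finite_subset[of _ "snd ` B"], force, simp add: finB)
      have "card ?X < w" "card ?Y < w"
        using that pq by (auto simp: wide_def tall_def not_le)
      moreover have "blk (p, q) \<subseteq> ?X \<times> ?Y"
        by (force simp: blk_def B_def C_def)
      then have "card (blk (p, q)) \<le> card (?X \<times> ?Y)"
        using fin by (intro card_mono) auto
      ultimately show ?thesis
        by (simp add: card_cartesian_product) (meson less_imp_le mult_le_mono order_trans)
    qed
    have "A \<subseteq> (\<Union>pq\<in>A'. blk pq)" by (force simp: A'_def blk_def)
    then have "card A \<le> card (\<Union>pq\<in>A'. blk pq)"
      using blk_fin finA' by (intro card_mono) auto
    also have "\<dots> \<le> (\<Sum>pq\<in>A'. card (blk pq))"
      using finA' by (rule card_UN_le)
    also have "\<dots> \<le> (\<Sum>pq\<in>A'. w * w + (if pq \<in> wide \<union> tall then s * s else 0))"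
    proof (rule sum_mono)
      fix pq assume "pq \<in> A'"
      then show "card (blk pq) \<le> w * w + (if pq \<in> wide \<union> tall then s * s else 0)"
        using blk_small[of "fst pq" "snd pq"] blk_big[of "fst pq" "snd pq"] by auto
    qed
    also have "\<dots> = card A' * (w * w) + card (A' \<inter> (wide \<union> tall)) * (s * s)"
      using finA' by (simp only: sum.distrib sum.inter_restrict[symmetric]) simp
    also have "card (A' \<inter> (wide \<union> tall)) \<le> n' * N + n' * N"
    proof -
      have "card (A' \<inter> (wide \<union> tall)) \<le> card (wide \<union> tall)"
        using wide_card tall_card by (intro card_mono) auto
      also have "\<dots> \<le> card wide + card tall" by (rule card_Un_le)
      finally show ?thesis using wide_card tall_card by linarith
    qed
    finally have "card A \<le> card A' * (w * w) + (n' * N + n' * N) * (s * s)" by simp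
    then have "4 * card A \<le> card A' * s + 8 * N * s * (s * n')"
      unfolding s(1) by (simp add: algebra_simps)
    also have "\<dots> \<le> (8 * s * N * n') * s + 8 * N * s * (s * n')"
      by (intro add_mono mult_le_mono1 IH) simp
    also have "\<dots> = 16 * s * N * (s * n')" by (simp add: algebra_simps)
    also have "\<dots> \<le> 16 * s * N * (2 * n)" by (rule mult_le_mono2[OF sn'])
    also have "\<dots> = 4 * (8 * s * N * n)" by simp
    finally show ?thesis unfolding c by linarith
  qed
qed

section \<open>Corners\<close>

definition corner :: "(nat \<Rightarrow> nat \<Rightarrow> 'b) \<Rightarrow> nat \<Rightarrow> nat \<Rightarrow> bool" where
  "corner F x y \<longleftrightarrow>
     (F x y \<noteq> F (Suc x) y \<or> F x (Suc y) \<noteq> F (Suc x) (Suc y)) \<and>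
     (F x y \<noteq> F x (Suc y) \<or> F (Suc x) y \<noteq> F (Suc x) (Suc y))"

lemma constant_on_interval:
  fixes f :: "nat \<Rightarrow> 'b"
  assumes "\<And>z. a \<le> z \<Longrightarrow> z < b \<Longrightarrow> f z = f (Suc z)" "a \<le> x" "x \<le> b"
  shows "f x = f a"
  using assms(2,3) by (induction x rule: dec_induct) (auto simp: assms(1)[symmetric])

text \<open>A row step that is not constant in some column forces its two rows to be constant, and then
  the rows above and below as well.\<close>

lemma corner_free_cases:
  fixes F :: "nat \<Rightarrow> nat \<Rightarrow> 'b"
  assumes free: "\<And>x y. a \<le> x \<Longrightarrow> x < b \<Longrightarrow> c \<le> y \<Longrightarrow> y < d \<Longrightarrow> \<not> corner F x y"
  shows "(\<forall>x\<in>{a..b}. \<forall>y\<in>{c..d}. F x y = F a y) \<or> (\<forall>x\<in>{a..b}. \<forall>y\<in>{c..d}. F x y = F x c)"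
proof (cases "\<forall>x y. a \<le> x \<and> x < b \<and> c \<le> y \<and> y \<le> d \<longrightarrow> F x y = F (Suc x) y")
  case True
  have "F x y = F a y" if "x \<in> {a..b}" "y \<in> {c..d}" for x y
    by (rule constant_on_interval[of a b "\<lambda>x. F x y"]) (use True that in auto)
  then show ?thesis by blast
next
  case False
  then obtain x y where xy: "a \<le> x" "x < b" "c \<le> y" "y \<le> d" "F x y \<noteq> F (Suc x) y"
    by blast
  have spread: "F x z = F x (Suc z) \<and> F (Suc x) z = F (Suc x) (Suc z)"
    if "c \<le> z" "z < d" "F x z \<noteq> F (Suc x) z \<or> F x (Suc z) \<noteq> F (Suc x) (Suc z)" for z
    using free[of x z] xy that by (auto simp: corner_def)
  have up: "F x z \<noteq> F (Suc x) z" if "y \<le> z" "z \<le> d" for z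
    using that
  proof (induction z rule: dec_induct)
    case (step n)
    then show ?case using spread[of n] xy by auto
  qed (use xy in simp)
  have down: "F x z \<noteq> F (Suc x) z" if "z \<le> y" "c \<le> z" for z
    using that
  proof (induction z rule: inc_induct)
    case (step n)
    then show ?case using spread[of n] xy by auto
  qed (use xy in simp)
  have differ: "F x z \<noteq> F (Suc x) z" if "c \<le> z" "z \<le> d" for z
    using up[of z] down[of z] that by linarith
  define const where "const = (\<lambda>u. \<forall>z. c \<le> z \<and> z < d \<longrightarrow> F u z = F u (Suc z))"
  have "const x" using spread differ by (auto simp: const_def)
  \<comment> \<open>If one of two neighbouring rows is constant over a column step and the other is
    not, the two rows differ within that step, and the four entries form a corner.\<close>
  have fwd: "const (Suc u)" if "const u" "a \<le> u" "u < b" for u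
    unfolding const_def
  proof (intro allI impI)
    fix z assume "c \<le> z \<and> z < d"
    then show "F (Suc u) z = F (Suc u) (Suc z)" using free[of u z] that by (auto simp: corner_def const_def)
  qed
  have bwd: "const u" if "const (Suc u)" "a \<le> u" "u < b" for u
    unfolding const_def
  proof (intro allI impI)
    fix z assume "c \<le> z \<and> z < d"
    then show "F u z = F u (Suc z)" using free[of u z] that by (auto simp: corner_def const_def)
  qed
  have "const u" if "x \<le> u" "u \<le> b" for u
    using that by (induction u rule: dec_induct) (use \<open>const x\<close> fwd xy in auto)
  moreover have "const u" if "u \<le> x" "a \<le> u" for u
    using that by (induction u rule: inc_induct) (use \<open>const x\<close> bwd xy in auto)
  ultimately have "const u" if "a \<le> u" "u \<le> b" for u
    using that by (meson nat_le_linear)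
  then have "F u z = F u c" if "u \<in> {a..b}" "z \<in> {c..d}" for u z
    using that constant_on_interval[of c d "F u" z] by (auto simp: const_def)
  then show ?thesis by blast
qed

text \<open>In a vertical zone all rows coincide; in a horizontal one every entry equals that of
  column \<open>c\<close> in its row. So a single column decides whether two rows agree on the
  zone.\<close>

lemma corner_free_rows_agree:
  assumes "\<And>x y. a \<le> x \<Longrightarrow> x < b \<Longrightarrow> c \<le> y \<Longrightarrow> y < d \<Longrightarrow> \<not> corner F x y"
    and "x \<in> {a..b}" "x' \<in> {a..b}" "y \<in> {c..d}" "F x c = F x' c"
  shows "F x y = F x' y"
proof -
  have "(\<forall>x\<in>{a..b}. \<forall>y\<in>{c..d}. F x y = F a y) \<or> (\<forall>x\<in>{a..b}. \<forall>y\<in>{c..d}. F x y = F x c)"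
    by (rule corner_free_cases) (rule assms(1))
  then show ?thesis
    using assms(2-) by metis
qed

section \<open>From corners to mixed minors\<close>

lemma submatrix_interval_index:
  assumes "b \<le> dim_row M" "d \<le> dim_col M" "a \<le> x" "x < b" "c \<le> y" "y < d"
  shows "submatrix M {a..<b} {c..<d} $$ (x - a, y - c) = M $$ (x, y)"
proof -
  have "{z \<in> {a..<b}. z < x} = {a..<x}" "{z \<in> {c..<d}. z < y} = {c..<y}"
    using assms by auto
  then show ?thesis
    using submatrix_index_card[of x M y "{a..<b}" "{c..<d}"] assms by simp
qed

lemma dim_submatrix_interval:
  assumes "b \<le> dim_row M" "d \<le> dim_col M"
  shows "dim_row (submatrix M {a..<b} {c..<d}) = b - a" "dim_col (submatrix M {a..<b} {c..<d}) = d - c"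
proof -
  have "{i. i < dim_row M \<and> i \<in> {a..<b}} = {a..<b}" "{i. i < dim_col M \<and> i \<in> {c..<d}} = {c..<d}"
    using assms by auto
  then show "dim_row (submatrix M {a..<b} {c..<d}) = b - a" "dim_col (submatrix M {a..<b} {c..<d}) = d - c"
    by (simp_all add: dim_submatrix)
qed

lemma mixed_submatrix_corner:
  assumes dims: "b \<le> dim_row M" "d \<le> dim_col M"
    and "a \<le> x" "Suc x < b" "c \<le> y" "Suc y < d" and "corner (\<lambda>x y. M $$ (x, y)) x y"
  shows "mixed_mat (submatrix M {a..<b} {c..<d})"
proof -
  let ?S = "submatrix M {a..<b} {c..<d}"
  define u v where "u = x - a" and "v = y - c"
  have S: "?S $$ (u, v) = M $$ (x, y)" "?S $$ (Suc u, v) = M $$ (Suc x, y)"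
    "?S $$ (u, Suc v) = M $$ (x, Suc y)" "?S $$ (Suc u, Suc v) = M $$ (Suc x, Suc y)"
    using assms submatrix_interval_index[OF dims, of a x c y]
      submatrix_interval_index[OF dims, of a "Suc x" c y]
      submatrix_interval_index[OF dims, of a x c "Suc y"]
      submatrix_interval_index[OF dims, of a "Suc x" c "Suc y"]
    by (auto simp: u_def v_def Suc_diff_le)
  have uv: "Suc u < dim_row ?S" "Suc v < dim_col ?S"
    using assms by (auto simp: dim_submatrix_interval u_def v_def)
  have "\<not> vertical_mat ?S"
  proof
    assume "vertical_mat ?S"
    then have "?S $$ (u, v) = ?S $$ (Suc u, v)" "?S $$ (u, Suc v) = ?S $$ (Suc u, Suc v)"
      using uv unfolding vertical_mat_def by auto
    then show False using assms(7) unfolding S corner_def by auto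
  qed
  moreover have "\<not> horizontal_mat ?S"
  proof
    assume "horizontal_mat ?S"
    then have "?S $$ (u, v) = ?S $$ (u, Suc v)" "?S $$ (Suc u, v) = ?S $$ (Suc u, Suc v)"
      using uv unfolding horizontal_mat_def by auto
    then show False using assms(7) unfolding S corner_def by auto
  qed
  ultimately show ?thesis unfolding mixed_mat_def ..
qed

lemma consecutive_partition_cuts:
  assumes "p 0 = 0" "p k = n" and less: "\<And>i. i < k \<Longrightarrow> p i < p (Suc i)"
  shows "consecutive_partition n k ((\<lambda>i. {p i..<p (Suc i)}) ` {..<k})"
proof -
  have mono: "p i \<le> p j" if "i \<le> j" "j \<le> k" for i j
    using that
  proof (induction j rule: dec_induct)
    case (step j)
    then show ?case using less[of j] by simp
  qed simp
  have disj: "{p i..<p (Suc i)} \<inter> {p j..<p (Suc j)} = {}" if "i < j" "j < k" for i j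
    using mono[of "Suc i" j] that by auto
  then have disj': "{p i..<p (Suc i)} \<inter> {p j..<p (Suc j)} = {}" if "i \<noteq> j" "i < k" "j < k" for i j
    using that by (metis Int_commute linorder_neqE_nat)
  have cover: "\<exists>i<j. p i \<le> x \<and> x < p (Suc i)" if "x < p j" "j \<le> k" for x j
    using that
  proof (induction j)
    case (Suc j)
    then show ?case by (cases "x < p j") (auto intro: less_SucI)
  qed (simp add: \<open>p 0 = 0\<close>)
  have "inj_on (\<lambda>i. {p i..<p (Suc i)}) {..<k}"
    using disj' less by (intro inj_onI) (metis Int_absorb atLeastLessThan_empty_iff lessThan_iff not_le order_less_irrefl)
  moreover have "partition_on {..<n} ((\<lambda>i. {p i..<p (Suc i)}) ` {..<k})"
  proof (rule partition_onI)
    have "p (Suc i) \<le> n" if "i < k" for i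
      using mono[of "Suc i" k] that \<open>p k = n\<close> by simp
    then have "x < n" if "i < k" "x < p (Suc i)" for i x
      using that less_le_trans by blast
    moreover have "\<exists>i<k. p i \<le> x \<and> x < p (Suc i)" if "x < n" for x
      using cover[of x k] that \<open>p k = n\<close> by simp
    ultimately show "\<Union> ((\<lambda>i. {p i..<p (Suc i)}) ` {..<k}) = {..<n}"
      by (simp add: set_eq_iff) blast
    show "disjnt q q'" if q: "q \<in> (\<lambda>i. {p i..<p (Suc i)}) ` {..<k}" "q' \<in> (\<lambda>i. {p i..<p (Suc i)}) ` {..<k}" "q \<noteq> q'"
      for q q'
    proof -
      obtain i j where ij: "i < k" "j < k" "q = {p i..<p (Suc i)}" "q' = {p j..<p (Suc j)}"
        using q by blast
      then show ?thesis using disj'[of i j] q(3) unfolding disjnt_def by metis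
    qed
    show "{} \<notin> (\<lambda>i. {p i..<p (Suc i)}) ` {..<k}"
      using less by (auto simp: not_le)
  qed
  ultimately show ?thesis
    unfolding consecutive_partition_def by (auto simp: card_image)
qed

text \<open>The 0/1 matrix to which \<open>marcus_tardos\<close> is applied. Line \<open>u\<close>
  stands for the union of the parts \<open>u\<close> and \<open>Suc u\<close>, a candidate for
  merging.\<close>

definition adjacent_mixed :: "nat \<Rightarrow> (nat \<Rightarrow> nat \<Rightarrow> 'b) \<Rightarrow> (nat \<Rightarrow> nat) \<Rightarrow> (nat \<times> nat) set" where
  "adjacent_mixed n F b = {(u, v). \<exists>x y. Suc x < n \<and> Suc y < n \<and> corner F x y \<and>
     {b x, b (Suc x)} \<subseteq> {u, Suc u} \<and> {b y, b (Suc y)} \<subseteq> {v, Suc v}}"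

text \<open>Neighbouring entries of \<open>adjacent_mixed\<close> share a part of the division, so only every other
  line of the grid minor is used.\<close>

lemma mixed_minor_from_grid:
  fixes M :: "'b mat"
  assumes dims: "dim_row M = n" "dim_col M = n" and "k \<ge> 1" and b: "mono b"
    and "grid_minor (2 * k) (adjacent_mixed n (\<lambda>x y. M $$ (x, y)) b)"
  shows "\<not> mixed_free k M"
proof -
  let ?F = "\<lambda>x y. M $$ (x, y)"
  obtain r c where rc: "\<forall>i<2 * k. \<forall>j<2 * k. \<exists>u v. (u, v) \<in> adjacent_mixed n ?F b \<and>
      r i \<le> u \<and> u < r (Suc i) \<and> c j \<le> v \<and> v < c (Suc j)"
    using assms(5) unfolding grid_minor_def by blast
  \<comment> \<open>As \<open>b\<close> is monotone, the indices counted form an initial segment, so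
    cut \<open>i\<close> is where the parts from \<open>r (2 * i)\<close> on begin. The outer cuts
    are moved to 0 and \<open>n\<close> to cover the whole matrix.\<close>
  define cut where "cut = (\<lambda>(r :: nat \<Rightarrow> nat) i. if i = 0 then 0 else if i = k then n
     else card {x. x < n \<and> b x < r (2 * i)})"
  have below: "x < card {x. x < n \<and> b x < t} \<longleftrightarrow> x < n \<and> b x < t" for x t
  proof -
    have "\<exists>m. {x. x < n \<and> b x < t} = {..<m}"
    proof (induction n)
      case (Suc n)
      show ?case
      proof (cases "b n < t")
        case True
        then have "{x. x < Suc n \<and> b x < t} = {..<Suc n}"
          using monoD[OF b] by (fastforce simp: less_Suc_eq_le intro: le_less_trans)
        then show ?thesis by blast
      next
        case False
        then have "{x. x < Suc n \<and> b x < t} = {x. x < n \<and> b x < t}"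
          by (auto simp: less_Suc_eq)
        then show ?thesis using Suc by simp
      qed
    qed auto
    then have "{x. x < n \<and> b x < t} = {..<card {x. x < n \<and> b x < t}}"
      by (metis card_lessThan)
    then show ?thesis by blast
  qed
  have mono_rc: "r i < r (Suc i)" "c i < c (Suc i)" if i: "i < 2 * k" for i
  proof -
    obtain u v where "r i \<le> u" "u < r (Suc i)" "c i \<le> v" "v < c (Suc i)"
      using rc[rule_format, OF i i] by blast
    then show "r i < r (Suc i)" "c i < c (Suc i)" by linarith+
  qed
  \<comment> \<open>From \<open>u < r (Suc (2 * i))\<close> it follows that
    \<open>Suc u < r (2 * Suc i)\<close>: the skipped odd interval makes room for the second part
    that the corner may touch.\<close>
  have inside: "cut r i \<le> x \<and> Suc x < cut r (Suc i)" 
    if "i < k" "r (2 * i) \<le> u" "u < r (Suc (2 * i))" "r (Suc (2 * i)) < r (2 * Suc i)"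
      "Suc x < n" "{b x, b (Suc x)} \<subseteq> {u, Suc u}" for r i x u
  proof -
    have "b x \<ge> u" "b (Suc x) < r (2 * Suc i)"
      using that by auto
    then show ?thesis
      using that below[of x "r (2 * i)"] below[of "Suc x" "r (2 * Suc i)"]
      by (auto simp: cut_def not_less)
  qed
  have "\<exists>x y. Suc x < n \<and> Suc y < n \<and> corner ?F x y \<and> cut r i \<le> x \<and> Suc x < cut r (Suc i)
       \<and> cut c j \<le> y \<and> Suc y < cut c (Suc j)" if "i < k" "j < k" for i j
  proof -
    have ij: "2 * i < 2 * k" "2 * j < 2 * k" using that by auto
    obtain u v where uv: "(u, v) \<in> adjacent_mixed n ?F b" "r (2 * i) \<le> u" "u < r (Suc (2 * i))"
      "c (2 * j) \<le> v" "v < c (Suc (2 * j))"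
      using rc[rule_format, OF ij] by blast
    then obtain x y where xy: "Suc x < n" "Suc y < n" "corner ?F x y"
      "{b x, b (Suc x)} \<subseteq> {u, Suc u}" "{b y, b (Suc y)} \<subseteq> {v, Suc v}"
      unfolding adjacent_mixed_def by blast
    have "r (Suc (2 * i)) < r (2 * Suc i)" "c (Suc (2 * j)) < c (2 * Suc j)"
      using mono_rc(1)[of "Suc (2 * i)"] mono_rc(2)[of "Suc (2 * j)"] that by auto
    then have "cut r i \<le> x \<and> Suc x < cut r (Suc i)" "cut c j \<le> y \<and> Suc y < cut c (Suc j)"
      using inside[of i r u x] inside[of j c v y] that uv xy by blast+
    then show ?thesis using xy by blast
  qed
  note corners = this
  have cut0: "cut t 0 = 0" "cut t k = n" for t
    using \<open>k \<ge> 1\<close> by (auto simp: cut_def)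
  have cut_le: "cut t i \<le> n" for t i
  proof -
    have "card {x. x < n \<and> b x < t'} \<le> card {..<n}" for t' by (rule card_mono) auto
    then show ?thesis by (simp add: cut_def)
  qed
  have less: "cut r i < cut r (Suc i)" "cut c i < cut c (Suc i)" if "i < k" for i
    using corners[OF that that] by auto
  let ?R = "(\<lambda>i. {cut r i..<cut r (Suc i)}) ` {..<k}" and ?C = "(\<lambda>i. {cut c i..<cut c (Suc i)}) ` {..<k}"
  have "mixed_mat (submatrix M {cut r i..<cut r (Suc i)} {cut c j..<cut c (Suc j)})"
    if "i < k" "j < k" for i j
    using corners[OF that] mixed_submatrix_corner[of "cut r (Suc i)" M "cut c (Suc j)"] cut_le dims
    by metis
  moreover have "consecutive_partition n k ?R" "consecutive_partition n k ?C"
    using consecutive_partition_cuts cut0 less by blast+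
  ultimately have "is_mixed_minor k M ?R ?C"
    unfolding is_mixed_minor_def dims by auto
  then show ?thesis
    unfolding mixed_free_def by blast
qed

section \<open>Contraction sequences between refining partitions\<close>

lemma refines_nonempty_sub:
  assumes "refines D P Q" "Y \<in> Q"
  obtains X where "X \<in> P" "X \<subseteq> Y"
proof -
  have "partition_on Y {X \<in> P. X \<subseteq> Y}" by (rule refines_obtains_subset[OF assms])
  moreover have "Y \<noteq> {}" using assms unfolding refines_def partition_on_def by metis
  ultimately have "{X \<in> P. X \<subseteq> Y} \<noteq> {}" by (auto dest: partition_onD1)
  then show thesis using that by blast
qed

text \<open>Sending each part of \<open>Q\<close> to a part of \<open>P\<close> inside it is
  injective, because parts of \<open>Q\<close> are disjoint and parts of \<open>P\<close> nonempty.
  Counts made in the finest partition thus bound all later ones.\<close>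

lemma card_parts_within_le:
  assumes "refines D P Q" "finite P"
  shows "card {Y \<in> Q. Y \<subseteq> S} \<le> card {X \<in> P. X \<subseteq> S}"
proof -
  have "\<forall>Y\<in>Q. \<exists>X. X \<in> P \<and> X \<subseteq> Y"
    using refines_nonempty_sub[OF assms(1)] by metis
  then obtain f where f: "\<And>Y. Y \<in> Q \<Longrightarrow> f Y \<in> P \<and> f Y \<subseteq> Y" by metis
  have "Y = Z" if "Y \<in> Q" "Z \<in> Q" "f Y = f Z" for Y Z
  proof (rule ccontr)
    assume "Y \<noteq> Z"
    have "disjoint Q" "{} \<notin> P" using assms(1) by (auto simp: refines_def partition_on_def)
    then have "Y \<inter> Z = {}" using \<open>Y \<noteq> Z\<close> that by (auto dest: disjointD)
    then have "f Y = {}" using f[of Y] f[of Z] that by auto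
    then show False using f[of Y] that(1) \<open>{} \<notin> P\<close> by metis
  qed
  then have "inj_on f {Y \<in> Q. Y \<subseteq> S}" by (intro inj_onI) auto
  moreover have "f ` {Y \<in> Q. Y \<subseteq> S} \<subseteq> {X \<in> P. X \<subseteq> S}" using f by blast
  ultimately show ?thesis using assms(2) by (intro card_inj_on_le) auto
qed

text \<open>If no part of \<open>P'\<close> contained two parts of \<open>P\<close>, each would
  equal the only one it contains, and the partitions would refine each other.\<close>

lemma merge_step_exists:
  assumes "refines D P P'" "P \<noteq> P'"
  obtains X1 X2 Y where "X1 \<in> P" "X2 \<in> P" "X1 \<noteq> X2" "Y \<in> P'" "X1 \<subseteq> Y" "X2 \<subseteq> Y"
proof -
  have "\<exists>X1\<in>P. \<exists>X2\<in>P. \<exists>Y\<in>P'. X1 \<noteq> X2 \<and> X1 \<subseteq> Y \<and> X2 \<subseteq> Y"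
  proof (rule ccontr)
    assume none: "\<not> ?thesis"
    have "Y \<in> P" if "Y \<in> P'" for Y
    proof -
      obtain X where X: "X \<in> P" "X \<subseteq> Y" using refines_nonempty_sub[OF assms(1) \<open>Y \<in> P'\<close>] .
      have "{X' \<in> P. X' \<subseteq> Y} = {X}" using none X that by blast
      then have "Y = X"
        using partition_onD1[OF refines_obtains_subset[OF assms(1) that]] by simp
      then show ?thesis using X by simp
    qed
    then have "refines D P' P" using assms(1) by (auto simp: refines_def)
    then show False using refines_asym[OF assms(1)] assms(2) by blast
  qed
  then show thesis using that by blast
qed

lemma partition_on_merge:
  assumes "partition_on D P" "X1 \<in> P" "X2 \<in> P" "X1 \<noteq> X2"
  shows "partition_on D (insert (X1 \<union> X2) (P - {X1, X2}))"
proof (rule partition_onI)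
  have disj: "disjnt X Y" if "X \<in> P" "Y \<in> P" "X \<noteq> Y" for X Y
    using assms(1) that by (auto simp: partition_on_def pairwise_def)
  show "\<Union> (insert (X1 \<union> X2) (P - {X1, X2})) = D"
    using assms partition_onD1[OF assms(1)] by auto
  show "disjnt p q" if "p \<in> insert (X1 \<union> X2) (P - {X1, X2})"
    "q \<in> insert (X1 \<union> X2) (P - {X1, X2})" "p \<noteq> q" for p q
    using that assms by (auto intro: disj)
  show "{} \<notin> insert (X1 \<union> X2) (P - {X1, X2})"
    using assms partition_onD3[OF assms(1)] by auto
qed

text \<open>Induction on the number of parts. The relation records that every partition visited lies
  between \<open>P\<close> and \<open>P'\<close>, which is the condition under which error degrees
  are bounded later.\<close>

lemma merge_chain:
  assumes "refines D P P'" "finite D"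
  shows "(\<lambda>Q R. merges_two_parts Q R \<and> (\<forall>S\<in>{Q, R}. refines D P S \<and> refines D S P'))\<^sup>*\<^sup>* P P'"
  using assms(1)
proof (induction "card P" arbitrary: P rule: less_induct)
  case less
  have P: "partition_on D P" "partition_on D P'" using less.prems by (auto simp: refines_def)
  have finP: "finite P" using finite_elements[OF assms(2) P(1)] .
  show ?case
  proof (cases "P = P'")
    case False
    obtain X1 X2 Y where X: "X1 \<in> P" "X2 \<in> P" "X1 \<noteq> X2" "Y \<in> P'" "X1 \<subseteq> Y" "X2 \<subseteq> Y"
      using merge_step_exists[OF less.prems False] .
    define Q where "Q = insert (X1 \<union> X2) (P - {X1, X2})"
    have Q: "partition_on D Q" unfolding Q_def by (rule partition_on_merge[OF P(1) X(1-3)])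
    have PQ: "refines D P Q" using P Q X unfolding refines_def Q_def by blast
    have QP': "refines D Q P'" using P Q X less.prems unfolding refines_def Q_def by blast
    have "card P = card {X1, X2} + card (P - {X1, X2})"
      using finP X by (subst card_Un_disjoint[symmetric]) (auto intro: arg_cong[of _ _ card])
    moreover have "card Q \<le> Suc (card (P - {X1, X2}))"
      unfolding Q_def by (rule card_insert_le_m1) auto
    ultimately have "card Q < card P" using X(3) by simp
    from less.hyps[OF this QP']
    have "(\<lambda>Q R. merges_two_parts Q R \<and> (\<forall>S\<in>{Q, R}. refines D P S \<and> refines D S P'))\<^sup>*\<^sup>* Q P'"
      by (rule mono_rtranclp[rule_format, rotated]) (use refines_trans[OF PQ] in blast)
    moreover have "merges_two_parts P Q" unfolding merges_two_parts_def Q_def using X by blast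
    ultimately show ?thesis
      using PQ QP' less.prems refines_refl[OF P(1)] by (intro converse_rtranclp_into_rtranclp[of _ P Q]) auto
  qed simp
qed

definition bounded_partition :: "'a set \<Rightarrow> 'a rel list \<Rightarrow> nat \<Rightarrow> 'a set set \<Rightarrow> bool" where
  "bounded_partition D Es d P \<longleftrightarrow> partition_on D P \<and> (\<forall>X\<in>P. error_degree Es P X \<le> d)"

definition bounded_merge :: "'a set \<Rightarrow> 'a rel list \<Rightarrow> nat \<Rightarrow> 'a set set \<Rightarrow> 'a set set \<Rightarrow> bool" where
  "bounded_merge D Es d P Q \<longleftrightarrow>
     merges_two_parts P Q \<and> bounded_partition D Es d P \<and> bounded_partition D Es d Q"

lemma bounded_merge_chain:
  assumes "refines D P P'" "finite D"
    and "\<And>Q X. refines D P Q \<Longrightarrow> refines D Q P' \<Longrightarrow> X \<in> Q \<Longrightarrow> error_degree Es Q X \<le> d"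
  shows "(bounded_merge D Es d)\<^sup>*\<^sup>* P P'"
proof (rule mono_rtranclp[rule_format, OF _ merge_chain[OF assms(1,2)]])
  fix Q R
  assume "merges_two_parts Q R \<and> (\<forall>S\<in>{Q, R}. refines D P S \<and> refines D S P')"
  then show "bounded_merge D Es d Q R"
    using assms(3) by (auto simp: bounded_merge_def bounded_partition_def refines_def)
qed

text \<open>\<open>bounded_merge\<close> asserts the bound only at the two ends of a step, so an
  empty chain carries none; hence the separate assumption on the final partition.\<close>

lemma twin_width_leI:
  assumes "(bounded_merge D Es d)\<^sup>*\<^sup>* ((\<lambda>v. {v}) ` D) ({D} - {{}})"
    and "bounded_partition D Es d ({D} - {{}})"
  shows "twin_width D Es \<le> d"
proof -
  have "\<exists>Ps. Ps \<noteq> [] \<and> hd Ps = P \<and> last Ps = {D} - {{}} \<and> successively merges_two_parts Ps \<and>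
      (\<forall>Q\<in>set Ps. bounded_partition D Es d Q)"
    if "(bounded_merge D Es d)\<^sup>*\<^sup>* P ({D} - {{}})" for P
    using that
  proof (induction rule: converse_rtranclp_induct)
    case base
    then show ?case using assms(2) by (intro exI[of _ "[{D} - {{}}]"]) simp
  next
    case (step P Q)
    then obtain Ps where "Ps \<noteq> []" "hd Ps = Q" "last Ps = {D} - {{}}"
      "successively merges_two_parts Ps" "\<forall>Q\<in>set Ps. bounded_partition D Es d Q" by blast
    then show ?case using step(1)
      by (intro exI[of _ "P # Ps"]) (auto simp: bounded_merge_def successively_Cons)
  qed
  from this[OF assms(1)] obtain Ps where "Ps \<noteq> []" "hd Ps = (\<lambda>v. {v}) ` D" "last Ps = {D} - {{}}"
    "successively merges_two_parts Ps" "\<forall>Q\<in>set Ps. bounded_partition D Es d Q" by blast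
  then have "has_d_sequence D Es d"
    unfolding has_d_sequence_def contraction_sequence_def
    by (intro exI[of _ Ps]) (auto simp: bounded_partition_def)
  then show ?thesis unfolding twin_width_def by (rule Least_le)
qed

section \<open>Divisions of the ordering\<close>

lemma card_image_le_card_image:
  assumes "finite S" "\<And>x x'. x \<in> S \<Longrightarrow> x' \<in> S \<Longrightarrow> g x = g x' \<Longrightarrow> f x = f x'"
  shows "card (f ` S) \<le> card (g ` S)"
proof -
  have "f x = f (inv_into S g (g x))" if "x \<in> S" for x
    using that assms(2) by (metis f_inv_into_f imageI inv_into_into)
  then have "f ` S \<subseteq> (f \<circ> inv_into S g) ` g ` S" by fastforce
  then show ?thesis
    using assms(1) by (meson finite_imageI surj_card_le)
qed

text \<open>Agrees with \<open>ordered_matrix\<close> within its dimensions but is a total function,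
  so that \<open>corner\<close> applies directly.\<close>

definition entry :: "'a rel list \<Rightarrow> 'a list \<Rightarrow> nat \<Rightarrow> nat \<Rightarrow> int list" where
  "entry Es vs x y = map (\<lambda>E. pair_code E (vs ! x) (vs ! y)) Es"

lemma pair_code_eq_iff:
  "pair_code E x y = pair_code E x' y' \<longleftrightarrow>
     ((x, y) \<in> E \<longleftrightarrow> (x', y') \<in> E) \<and> ((y, x) \<in> E \<longleftrightarrow> (y', x') \<in> E)"
  by (simp add: pair_code_def)

lemma entry_eq_iff:
  "entry Es vs x y = entry Es vs x' y' \<longleftrightarrow>
     (\<forall>E\<in>set Es. ((vs ! x, vs ! y) \<in> E \<longleftrightarrow> (vs ! x', vs ! y') \<in> E) \<and>
        ((vs ! y, vs ! x) \<in> E \<longleftrightarrow> (vs ! y', vs ! x') \<in> E))"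
  by (simp add: entry_def pair_code_eq_iff)

text \<open>An entry records both directions of each relation, so the transposed entry carries the
  same information. Therefore grouping by rows also controls the columns.\<close>

lemma entry_swap: "entry Es vs x y = entry Es vs x' y' \<longleftrightarrow> entry Es vs y x = entry Es vs y' x'"
  by (auto simp: entry_eq_iff)

lemma corner_entry_swap: "corner (entry Es vs) x y \<longleftrightarrow> corner (entry Es vs) y x"
  unfolding corner_def
  using entry_swap[of Es vs x y "Suc x" y] entry_swap[of Es vs x "Suc y" "Suc x" "Suc y"]
    entry_swap[of Es vs x y x "Suc y"] entry_swap[of Es vs "Suc x" y "Suc x" "Suc y"] by metis

lemma card_entries_le: "card (range (\<lambda>(x, y). entry Es vs x y)) \<le> 4 ^ length Es"
  and finite_entries: "finite (range (\<lambda>(x, y). entry Es vs x y))"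
proof -
  let ?L = "{l. set l \<subseteq> {2, 1, - 1, 0 :: int} \<and> length l = length Es}"
  have sub: "range (\<lambda>(x, y). entry Es vs x y) \<subseteq> ?L"
    by (auto simp: entry_def pair_code_def)
  have fin: "finite ?L" by (rule finite_lists_length_eq) simp
  have "card ?L = card {2, 1, - 1, 0 :: int} ^ length Es" by (rule card_lists_length_eq) simp
  also have "card {2, 1, - 1, 0 :: int} = 4" by simp
  finally show "card (range (\<lambda>(x, y). entry Es vs x y)) \<le> 4 ^ length Es"
    using card_mono[OF fin sub] by simp
  show "finite (range (\<lambda>(x, y). entry Es vs x y))" using sub fin by (rule finite_subset)
qed

text \<open>A division of the ordering into intervals is given by the map \<open>b\<close> sending each index to the
  number of its part. The same division is used for rows and columns.\<close>

definition division :: "nat \<Rightarrow> (nat \<Rightarrow> nat) \<Rightarrow> nat \<Rightarrow> bool" where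
  "division n b q \<longleftrightarrow> (\<forall>x. b x \<le> b (Suc x) \<and> b (Suc x) \<le> Suc (b x)) \<and> (\<forall>x<n. b x < q)"

lemma division_mono: "division n b q \<Longrightarrow> mono b"
  unfolding division_def by (intro mono_iff_le_Suc[THEN iffD2]) blast

section \<open>Mixed zones and blocks of a division\<close>

locale ordered_structure =
  fixes D :: "'a set" and Es :: "'a rel list" and vs :: "'a list" and n :: nat
  assumes ordering: "domain_ordering D vs"
  defines "n \<equiv> length vs"
begin

lemma D_eq: "D = nth vs ` {..<n}"
  using ordering unfolding domain_ordering_def n_def by (auto simp: set_conv_nth)

lemma finite_D: "finite D"
  by (simp add: D_eq)

lemma nth_eq_iff: "x < n \<Longrightarrow> y < n \<Longrightarrow> vs ! x = vs ! y \<longleftrightarrow> x = y"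
  using ordering unfolding domain_ordering_def n_def by (simp add: nth_eq_iff_index_eq)

abbreviation "M \<equiv> entry Es vs"

definition mixed_parts :: "(nat \<Rightarrow> nat) \<Rightarrow> nat \<Rightarrow> nat \<Rightarrow> bool" where
  "mixed_parts b i j \<longleftrightarrow> (\<exists>x y. Suc x < n \<and> Suc y < n \<and> corner M x y \<and>
     b x = i \<and> b (Suc x) = i \<and> b y = j \<and> b (Suc y) = j)"

text \<open>The mixed value of part \<open>i\<close> counts the parts (as pairs \<open>(j, j)\<close>) and the boundaries between
  neighbouring parts (as pairs \<open>(j, j + 1)\<close>) that contain a corner within the rows of \<open>i\<close>.\<close>

definition mixed_items :: "(nat \<Rightarrow> nat) \<Rightarrow> nat \<Rightarrow> (nat \<times> nat) set" where
  "mixed_items b i = {(b y, b (Suc y)) | y. Suc y < n \<and>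
     (\<exists>x. Suc x < n \<and> corner M x y \<and> b x = i \<and> b (Suc x) = i)}"

lemma finite_mixed_items: "finite (mixed_items b i)"
proof -
  have "mixed_items b i \<subseteq> (\<lambda>y. (b y, b (Suc y))) ` {..<n}"
    by (auto simp: mixed_items_def)
  then show ?thesis by (rule finite_subset) simp
qed

lemma mixed_parts_sym: "mixed_parts b i j \<longleftrightarrow> mixed_parts b j i"
  unfolding mixed_parts_def using corner_entry_swap[of Es vs] by blast

lemma mixed_parts_iff: "mixed_parts b i j \<longleftrightarrow> (j, j) \<in> mixed_items b i"
  unfolding mixed_parts_def mixed_items_def by fastforce

lemma card_mixed_parts_le: "card {j. mixed_parts b i j} \<le> card (mixed_items b i)"
  by (rule card_inj_on_le[of "\<lambda>j. (j, j)"])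
    (auto simp: inj_on_def mixed_parts_iff finite_mixed_items)

lemma finite_mixed_parts: "finite {j. mixed_parts b i j}"
  by (rule inj_on_finite[of "\<lambda>j. (j, j)" _ "mixed_items b i"])
    (auto simp: inj_on_def mixed_parts_iff finite_mixed_items)

lemma mixed_parts_compose: "mixed_parts b i j \<Longrightarrow> mixed_parts (m \<circ> b) (m i) (m j)"
  unfolding mixed_parts_def comp_def by metis

text \<open>The invariant by which vertices are grouped: the part of \<open>x\<close> and its row,
  with \<open>None\<close> masking the mixed zones and the indices from \<open>n\<close> on.\<close>

definition key :: "(nat \<Rightarrow> nat) \<Rightarrow> nat \<Rightarrow> nat \<times> (nat \<Rightarrow> int list option)" where
  "key b x = (b x, \<lambda>y. if y < n \<and> \<not> mixed_parts b (b x) (b y) then Some (M x y) else None)"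

definition block :: "(nat \<Rightarrow> nat) \<Rightarrow> nat \<Rightarrow> 'a set" where
  "block b x = nth vs ` {x'. x' < n \<and> key b x' = key b x}"

definition blocks :: "(nat \<Rightarrow> nat) \<Rightarrow> 'a set set" where
  "blocks b = block b ` {..<n}"

definition region :: "(nat \<Rightarrow> nat) \<Rightarrow> nat \<Rightarrow> 'a set" where
  "region b i = nth vs ` {x. x < n \<and> b x = i}"

lemma key_eq_iff:
  "key b x = key b x' \<longleftrightarrow>
     b x = b x' \<and> (\<forall>y<n. \<not> mixed_parts b (b x) (b y) \<longrightarrow> M x y = M x' y)"
  unfolding key_def by (auto simp: fun_eq_iff)

lemma nth_in_block: "x' < n \<Longrightarrow> vs ! x' \<in> block b x \<longleftrightarrow> key b x' = key b x"
  unfolding block_def using nth_eq_iff by (auto simp: image_iff)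

lemma nth_in_region: "x < n \<Longrightarrow> vs ! x \<in> region b i \<longleftrightarrow> b x = i"
  unfolding region_def using nth_eq_iff by (auto simp: image_iff)

lemma block_subset_region: "block b x \<subseteq> region b (b x)"
  unfolding block_def region_def by (auto simp: key_eq_iff)

lemma partition_blocks: "partition_on D (blocks b)"
proof (rule partition_onI)
  show "\<Union> (blocks b) = D"
    unfolding blocks_def D_eq by (auto simp: block_def)
  show "{} \<notin> blocks b"
    unfolding blocks_def using nth_in_block by blast
  show "disjnt p q" if "p \<in> blocks b" "q \<in> blocks b" "p \<noteq> q" for p q
  proof -
    obtain x y where "p = block b x" "q = block b y" using \<open>p \<in> blocks b\<close> \<open>q \<in> blocks b\<close>
      unfolding blocks_def by blast
    then show ?thesis using \<open>p \<noteq> q\<close> nth_eq_iff by (auto simp: disjnt_def block_def)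
  qed
qed

lemma refines_blocks:
  assumes "\<And>x x'. key b x = key b x' \<Longrightarrow> key b' x = key b' x'"
  shows "refines D (blocks b) (blocks b')"
proof -
  have "block b x \<subseteq> block b' x" for x
    unfolding block_def using assms by blast
  then show ?thesis
    unfolding refines_def using partition_blocks by (auto simp: blocks_def)
qed

text \<open>Mixed zones stay mixed when parts are merged, so the coarser key compares fewer
  columns.\<close>

lemma refines_blocks_compose: "refines D (blocks b) (blocks (m \<circ> b))"
proof (rule refines_blocks)
  fix x x' assume "key b x = key b x'"
  then show "key (m \<circ> b) x = key (m \<circ> b) x'"
    unfolding key_eq_iff using mixed_parts_compose[of b _ _ m] by (metis comp_apply)
qed

text \<open>Go from \<open>(x', y')\<close> to \<open>(x, y')\<close> by the key of
  \<open>x\<close>, then to \<open>(x, y)\<close> by the key of \<open>y\<close> read through the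
  transposed matrix, where the zone is unmixed as well.\<close>

lemma homogeneous_block:
  assumes "x < n" "y < n" "\<not> mixed_parts b (b x) (b y)"
  shows "homogeneous Es (block b x) (block b y)"
proof -
  have const: "M x' y' = M x y" if "x' < n" "y' < n" "key b x' = key b x" "key b y' = key b y" for x' y'
  proof -
    have "M x' y' = M x y'"
      using that assms by (metis key_eq_iff)
    moreover have "M y' x = M y x"
      using that assms mixed_parts_sym by (metis key_eq_iff)
    then have "M x y' = M x y" using entry_swap[of Es vs] by metis
    ultimately show ?thesis by simp
  qed
  have same: "M x' y' = M x'' y''" if "vs ! x' \<in> block b x" "vs ! y' \<in> block b y" "vs ! x'' \<in> block b x"
    "vs ! y'' \<in> block b y" "x' < n" "y' < n" "x'' < n" "y'' < n" for x' y' x'' y''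
    using that by (simp add: nth_in_block const)
  have dest: "\<exists>z'<n. u = vs ! z'" if "u \<in> block b z" for u z
    using that unfolding block_def by auto
  show ?thesis
    unfolding homogeneous_def
  proof (intro ballI)
    fix E u u' w w'
    assume "E \<in> set Es" and *: "u \<in> block b x" "u' \<in> block b x" "w \<in> block b y" "w' \<in> block b y"
    obtain x' x'' y' y'' where "u = vs ! x'" "u' = vs ! x''" "w = vs ! y'" "w' = vs ! y''"
      "x' < n" "x'' < n" "y' < n" "y'' < n"
      using dest * by metis
    then show "((u, w) \<in> E \<longleftrightarrow> (u', w') \<in> E) \<and> ((w, u) \<in> E \<longleftrightarrow> (w', u') \<in> E)"
      using same[of x' y' x'' y''] * \<open>E \<in> set Es\<close> unfolding entry_eq_iff by blast
  qed
qed

text \<open>The columns outside the mixed zones of part \<open>i\<close> fall into at most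
  \<open>card (mixed_items b i) + 1\<close> groups, according to the number of mixed items to their left, and
  no corner lies between two columns of a group. So one column per group suffices.\<close>

lemma representative_columns:
  assumes "division n b q"
  shows "\<exists>Y. finite Y \<and> card Y \<le> Suc (card (mixed_items b i)) \<and>
    (\<forall>x<n. \<forall>x'<n. b x = i \<and> b x' = i \<and> (\<forall>y\<in>Y. M x y = M x' y) \<longrightarrow> key b x = key b x')"
proof -
  define I where "I = mixed_items b i"
  have finI: "finite I" by (simp add: I_def finite_mixed_items)
  note mono = monoD[OF division_mono[OF assms]]
  define G where "G = {y. y < n \<and> (b y, b y) \<notin> I}"
  \<comment> \<open>An item counts as left of \<open>y\<close> once its second part is at most
    \<open>b y\<close>, so the boundary entering the part of \<open>y\<close> is included. The
    values \<open>0\<close> to \<open>card I\<close> give the \<open>Suc (card I)\<close>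
    groups.\<close>
  define s where "s = (\<lambda>y. card {p \<in> I. snd p \<le> b y})"
  \<comment> \<open>The leftmost column of the group. For a value attained by no column of
    \<open>G\<close>, \<open>LEAST\<close> yields an unspecified index, which merely puts another
    element into \<open>Y\<close>.\<close>
  define rep where "rep = (\<lambda>t. LEAST y. y \<in> G \<and> s y = t)"
  define Y where "Y = rep ` {..card I}"
  have finY: "finite Y" by (simp add: Y_def)
  have "card Y \<le> card {..card I}" unfolding Y_def by (rule card_image_le) simp
  then have card_Y: "card Y \<le> Suc (card I)" by simp
  have agree: "M x y = M x' y"
    if x: "x < n" "x' < n" "b x = i" "b x' = i" and eq: "\<forall>y\<in>Y. M x y = M x' y" and y: "y \<in> G" for x x' y
  proof -
    define c where "c = rep (s y)"
    have c: "c \<in> G" "s c = s y"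
      unfolding c_def rep_def using LeastI[of "\<lambda>z. z \<in> G \<and> s z = s y" y] y by auto
    have "c \<le> y"
      unfolding c_def rep_def using y by (intro Least_le) simp
    have "s y \<le> card I" unfolding s_def using finI by (intro card_mono) auto
    then have "c \<in> Y" unfolding c_def Y_def by blast
    show ?thesis
    proof (rule corner_free_rows_agree[of "min x x'" "max x x'" c y M])
      fix u z assume uz: "min x x' \<le> u" "u < max x x'" "c \<le> z" "z < y"
      \<comment> \<open>All rows between \<open>x\<close> and \<open>x'\<close> lie in part
        \<open>i\<close>, so a corner among them is recorded in
        \<open>mixed_items b i\<close>.\<close>
      have "b u = i" "b (Suc u) = i"
        using uz x mono[of "min x x'" u] mono[of u "max x x'"] mono[of "min x x'" "Suc u"]
          mono[of "Suc u" "max x x'"]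
        by (auto simp: min_def max_def split: if_splits)
      show "\<not> corner M u z"
      proof
        assume "corner M u z"
        moreover have "Suc u < n" "Suc z < n" using uz x y by (auto simp: G_def)
        ultimately have item: "(b z, b (Suc z)) \<in> I"
          using \<open>b u = i\<close> \<open>b (Suc u) = i\<close> unfolding I_def mixed_items_def by blast
        \<comment> \<open>Either the item lies within the part of \<open>c\<close>, against
          \<open>c \<in> G\<close>, or it is counted for \<open>y\<close> but not for
          \<open>c\<close>, against \<open>s c = s y\<close>.\<close>
        have "\<not> b (Suc z) \<le> b c"
        proof
          assume "b (Suc z) \<le> b c"
          then have "b z = b c" "b (Suc z) = b c"
            using mono[of c z] mono[of z "Suc z"] uz by linarith+
          then show False using item c by (simp add: G_def)
        qed
        moreover have "b (Suc z) \<le> b y" using mono[of "Suc z" y] uz by simp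
        moreover have "b c \<le> b y" using mono \<open>c \<le> y\<close> by blast
        ultimately have "{p \<in> I. snd p \<le> b c} \<subset> {p \<in> I. snd p \<le> b y}"
          using item by force
        then have "s c < s y" unfolding s_def using finI by (intro psubset_card_mono) auto
        then show False using c by simp
      qed
    qed (use \<open>c \<le> y\<close> eq \<open>c \<in> Y\<close> in auto)
  qed
  have "key b x = key b x'"
    if "x < n" "x' < n" "b x = i" "b x' = i" "\<forall>y\<in>Y. M x y = M x' y" for x x'
    unfolding key_eq_iff
  proof (intro conjI allI impI)
    show "b x = b x'" using that by simp
    fix y assume "y < n" "\<not> mixed_parts b (b x) (b y)"
    then have "y \<in> G" using that by (simp add: G_def I_def mixed_parts_iff)
    then show "M x y = M x' y" using that agree by blast
  qed
  then show ?thesis using finY card_Y unfolding I_def by blast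
qed

text \<open>A block is determined by the entries of its row in at most \<open>Suc T\<close>
  representative columns, each with at most \<open>4 ^ length Es\<close> values.\<close>

lemma card_blocks_region_le:
  assumes "division n b q" "card (mixed_items b i) \<le> T"
  shows "card {X \<in> blocks b. X \<subseteq> region b i} \<le> (4 ^ length Es) ^ Suc T"
proof -
  obtain Y where Y: "finite Y" "card Y \<le> Suc (card (mixed_items b i))"
    and key: "\<forall>x<n. \<forall>x'<n. b x = i \<and> b x' = i \<and> (\<forall>y\<in>Y. M x y = M x' y) \<longrightarrow> key b x = key b x'"
    using representative_columns[OF assms(1), of i] by blast
  let ?S = "{x. x < n \<and> b x = i}" and ?K = "range (\<lambda>(x, y). M x y)"
  have fin: "finite ?S" by simp
  have "{X \<in> blocks b. X \<subseteq> region b i} \<subseteq> block b ` ?S"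
  proof
    fix X assume X: "X \<in> {X \<in> blocks b. X \<subseteq> region b i}"
    then obtain x where x: "x < n" "X = block b x" unfolding blocks_def by blast
    then have "vs ! x \<in> region b i" using X nth_in_block[of x b x] by auto
    then show "X \<in> block b ` ?S" using x nth_in_region by auto
  qed
  then have "card {X \<in> blocks b. X \<subseteq> region b i} \<le> card (block b ` ?S)"
    by (rule card_mono[rotated]) simp
  also have "\<dots> \<le> card ((\<lambda>x. restrict (M x) Y) ` ?S)"
  proof (rule card_image_le_card_image[OF fin])
    fix x x' assume x: "x \<in> ?S" "x' \<in> ?S" and eq: "restrict (M x) Y = restrict (M x') Y"
    have "\<forall>y\<in>Y. M x y = M x' y" using eq by (metis restrict_apply')
    then have "key b x = key b x'" using key x by blast
    then show "block b x = block b x'" by (simp add: block_def)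
  qed
  also have "\<dots> \<le> card (Y \<rightarrow>\<^sub>E ?K)"
  proof (rule card_mono)
    show "finite (Y \<rightarrow>\<^sub>E ?K)" by (rule finite_PiE[OF Y(1)]) (rule finite_entries)
    have "M x y \<in> ?K" for x y by (rule rangeI[of "\<lambda>(x, y). M x y" "(x, y)", simplified])
    then show "(\<lambda>x. restrict (M x) Y) ` ?S \<subseteq> Y \<rightarrow>\<^sub>E ?K"
      by (intro image_subsetI) (simp only: restrict_PiE_iff, blast)
  qed
  also have "\<dots> = card ?K ^ card Y" using Y by (simp add: card_funcsetE)
  also have "\<dots> \<le> (4 ^ length Es) ^ card Y" using card_entries_le by (intro power_mono) auto
  also have "\<dots> \<le> (4 ^ length Es) ^ Suc T" using Y assms by (intro power_increasing) auto
  finally show ?thesis .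
qed

text \<open>Mixedness is measured in the coarse division \<open>b\<close>, parts are counted in the
  fine partition \<open>P\<close>. A part not homogeneous with \<open>X\<close> lies in a region
  forming a mixed zone with that of \<open>X\<close>; there are at most \<open>T\<close> such
  regions, each with at most \<open>N\<close> parts.\<close>

lemma error_degree_between_le:
  assumes "refines D P Q" "refines D Q (blocks b)" "X \<in> Q"
    and N: "\<And>i. card {X \<in> P. X \<subseteq> region b i} \<le> N" and T: "\<And>i. card (mixed_items b i) \<le> T"
  shows "error_degree Es Q X \<le> T * N"
proof -
  have finP: "finite P" using assms(1) finite_elements[OF finite_D] by (auto simp: refines_def)
  have finQ: "finite Q" using assms(1) finite_elements[OF finite_D] by (auto simp: refines_def)
  obtain x where x: "x < n" "X \<subseteq> block b x"
    using assms(2,3) unfolding refines_def blocks_def by blast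
  let ?J = "{j. mixed_parts b (b x) j}"
  have "{Y \<in> Q. Y \<noteq> X \<and> \<not> homogeneous Es X Y} \<subseteq> (\<Union>j\<in>?J. {Y \<in> Q. Y \<subseteq> region b j})"
  proof
    fix Y assume Y: "Y \<in> {Y \<in> Q. Y \<noteq> X \<and> \<not> homogeneous Es X Y}"
    then obtain y where y: "y < n" "Y \<subseteq> block b y"
      using assms(2) unfolding refines_def blocks_def by blast
    have "\<not> homogeneous Es (block b x) (block b y)"
      using Y x y unfolding homogeneous_def by blast
    then have "mixed_parts b (b x) (b y)" using homogeneous_block x y by blast
    then show "Y \<in> (\<Union>j\<in>?J. {Y \<in> Q. Y \<subseteq> region b j})"
      using Y y block_subset_region[of b y] by blast
  qed
  then have "error_degree Es Q X \<le> card (\<Union>j\<in>?J. {Y \<in> Q. Y \<subseteq> region b j})"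
    unfolding error_degree_def using finQ finite_mixed_parts by (intro card_mono) auto
  also have "\<dots> \<le> (\<Sum>j\<in>?J. card {Y \<in> Q. Y \<subseteq> region b j})"
    by (rule card_UN_le[OF finite_mixed_parts])
  also have "\<dots> \<le> (\<Sum>j\<in>?J. N)"
    using card_parts_within_le[OF assms(1) finP] N by (intro sum_mono) (meson order_trans)
  also have "\<dots> \<le> T * N"
    using card_mixed_parts_le[of b "b x"] T[of "b x"] by simp
  finally show ?thesis .
qed

section \<open>Merging two neighbouring parts\<close>

definition merge_at :: "nat \<Rightarrow> nat \<Rightarrow> nat" where
  "merge_at i u = (if u \<le> i then u else u - 1)"

text \<open>A region after the merge is covered by at most two old regions.\<close>

lemma card_blocks_merged_region_le:
  assumes "\<And>j. card {X \<in> blocks b. X \<subseteq> region b j} \<le> N"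
  shows "card {X \<in> blocks b. X \<subseteq> region (merge_at i \<circ> b) j} \<le> 2 * N"
proof -
  have fin: "finite (blocks b)" by (simp add: blocks_def)
  have "{X \<in> blocks b. X \<subseteq> region (merge_at i \<circ> b) j} \<subseteq>
    {X \<in> blocks b. X \<subseteq> region b j} \<union> {X \<in> blocks b. X \<subseteq> region b (Suc j)}"
  proof
    fix X assume X: "X \<in> {X \<in> blocks b. X \<subseteq> region (merge_at i \<circ> b) j}"
    then obtain x where x: "x < n" "X = block b x" unfolding blocks_def by blast
    then have "vs ! x \<in> region (merge_at i \<circ> b) j" using X nth_in_block[of x b x] by auto
    then have "merge_at i (b x) = j" using x nth_in_region by simp
    then have "b x = j \<or> b x = Suc j" by (auto simp: merge_at_def split: if_splits)
    then show "X \<in> {X \<in> blocks b. X \<subseteq> region b j} \<union> {X \<in> blocks b. X \<subseteq> region b (Suc j)}"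
      using X x block_subset_region[of b x] by auto
  qed
  then have "card {X \<in> blocks b. X \<subseteq> region (merge_at i \<circ> b) j} \<le>
    card ({X \<in> blocks b. X \<subseteq> region b j} \<union> {X \<in> blocks b. X \<subseteq> region b (Suc j)})"
    using fin by (intro card_mono) auto
  also have "\<dots> \<le> card {X \<in> blocks b. X \<subseteq> region b j} + card {X \<in> blocks b. X \<subseteq> region b (Suc j)}"
    by (rule card_Un_le)
  also have "\<dots> \<le> 2 * N" using assms[of j] assms[of "Suc j"] by simp
  finally show ?thesis .
qed

lemma division_merge:
  assumes "division n b q" "Suc i < q"
  shows "division n (merge_at i \<circ> b) (q - 1)"
  unfolding division_def
proof (intro conjI allI impI)
  fix x
  have "b x \<le> b (Suc x)" "b (Suc x) \<le> Suc (b x)" using assms by (auto simp: division_def)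
  then show "(merge_at i \<circ> b) x \<le> (merge_at i \<circ> b) (Suc x)"
    "(merge_at i \<circ> b) (Suc x) \<le> Suc ((merge_at i \<circ> b) x)"
    by (auto simp: merge_at_def)
next
  fix x assume "x < n"
  then have "b x < q" using assms by (auto simp: division_def)
  then show "(merge_at i \<circ> b) x < q - 1" using assms(2) by (auto simp: merge_at_def)
qed

text \<open>The items seen by the rows of the united parts while the columns keep the old division.
  This includes corners across the boundary between the two parts.\<close>

definition joined_items :: "(nat \<Rightarrow> nat) \<Rightarrow> nat \<Rightarrow> (nat \<times> nat) set" where
  "joined_items b i = {(b y, b (Suc y)) | y. Suc y < n \<and>
     (\<exists>x. Suc x < n \<and> corner M x y \<and> {b x, b (Suc x)} \<subseteq> {i, Suc i})}"

lemma finite_joined_items: "finite (joined_items b i)"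
proof -
  have "joined_items b i \<subseteq> (\<lambda>y. (b y, b (Suc y))) ` {..<n}"
    by (auto simp: joined_items_def)
  then show ?thesis by (rule finite_subset) simp
qed

text \<open>Every new item is the image of an old one under the renumbering, since merging columns
  can only identify items. Joined items serve the united part, and the old items of the same part
  every other one.\<close>

lemma card_mixed_items_merge_le:
  assumes "\<And>j. card (mixed_items b j) \<le> T" "card (joined_items b i) \<le> T"
  shows "card (mixed_items (merge_at i \<circ> b) j) \<le> T"
proof -
  let ?m = "map_prod (merge_at i) (merge_at i)"
  have image: "card (mixed_items (merge_at i \<circ> b) j) \<le> card Z"
    if "finite Z" "mixed_items (merge_at i \<circ> b) j \<subseteq> ?m ` Z" for Z
    using that by (meson surj_card_le)
  show ?thesis
  proof (cases "j = i")
    case True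
    have "b x \<in> {i, Suc i}" if "merge_at i (b x) = i" for x
      using that by (auto simp: merge_at_def split: if_splits)
    then have "mixed_items (merge_at i \<circ> b) j \<subseteq> ?m ` joined_items b i"
      unfolding True mixed_items_def joined_items_def by fastforce
    then show ?thesis using image[OF finite_joined_items] assms(2) le_trans by blast
  next
    case False
    define j' where "j' = (if j \<le> i then j else Suc j)"
    have part: "b x = j'" if "merge_at i (b x) = j" for x
      using that False by (auto simp: merge_at_def j'_def split: if_splits)
    have "mixed_items (merge_at i \<circ> b) j \<subseteq> ?m ` mixed_items b j'"
    proof
      fix p assume "p \<in> mixed_items (merge_at i \<circ> b) j"
      then obtain x y where xy: "Suc x < n" "Suc y < n" "corner M x y" "merge_at i (b x) = j"
        "merge_at i (b (Suc x)) = j" and p: "p = ?m (b y, b (Suc y))"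
        unfolding mixed_items_def by auto
      have "(b y, b (Suc y)) \<in> mixed_items b j'"
        unfolding mixed_items_def using xy part by blast
      then show "p \<in> ?m ` mixed_items b j'" using p by (rule rev_image_eqI)
    qed
    then show ?thesis using image[OF finite_mixed_items] assms(1) le_trans by blast
  qed
qed

text \<open>A marked entry \<open>(i, v)\<close> accounts for at most two items,
  \<open>(v, v)\<close> and \<open>(v, Suc v)\<close>.\<close>

lemma card_joined_items_le:
  assumes "division n b q"
  shows "card (joined_items b i) \<le> 2 * card (adjacent_mixed n M b `` {i})"
proof -
  let ?A = "adjacent_mixed n M b `` {i}"
  have "finite ?A"
  proof (rule finite_subset)
    show "?A \<subseteq> {..<q}"
    proof
      fix v assume "v \<in> ?A"
      then obtain y where "Suc y < n" "b y \<in> {v, Suc v}" by (auto simp: adjacent_mixed_def)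
      moreover then have "b y < q" using assms by (auto simp: division_def)
      ultimately show "v \<in> {..<q}" by auto
    qed
  qed simp
  have "joined_items b i \<subseteq> (\<lambda>v. (v, v)) ` ?A \<union> (\<lambda>v. (v, Suc v)) ` ?A"
  proof
    fix p assume "p \<in> joined_items b i"
    then obtain x y where xy: "p = (b y, b (Suc y))" "Suc x < n" "Suc y < n" "corner M x y"
      "{b x, b (Suc x)} \<subseteq> {i, Suc i}" unfolding joined_items_def by blast
    have "b (Suc y) = b y \<or> b (Suc y) = Suc (b y)"
      using assms unfolding division_def by (metis le_antisym not_less_eq_eq)
    moreover from this have "b y \<in> ?A"
      using xy unfolding adjacent_mixed_def by fastforce
    ultimately show "p \<in> (\<lambda>v. (v, v)) ` ?A \<union> (\<lambda>v. (v, Suc v)) ` ?A"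
      using xy(1) by auto
  qed
  then have "card (joined_items b i) \<le> card ((\<lambda>v. (v, v)) ` ?A \<union> (\<lambda>v. (v, Suc v)) ` ?A)"
    using \<open>finite ?A\<close> by (intro card_mono) auto
  also have "\<dots> \<le> card ((\<lambda>v. (v, v)) ` ?A) + card ((\<lambda>v. (v, Suc v)) ` ?A)" by (rule card_Un_le)
  also have "\<dots> \<le> 2 * card ?A"
    using card_image_le[OF \<open>finite ?A\<close>, of "\<lambda>v. (v, v)"] card_image_le[OF \<open>finite ?A\<close>, of "\<lambda>v. (v, Suc v)"]
    by linarith
  finally show ?thesis .
qed

section \<open>Finding a merge and assembling the contraction sequence\<close>

lemma adjacent_mixed_subset:
  assumes "division n b q"
  shows "adjacent_mixed n M b \<subseteq> {..<q} \<times> {..<q}"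
proof
  fix p assume "p \<in> adjacent_mixed n M b"
  then obtain u v x y where p: "p = (u, v)" "Suc x < n" "Suc y < n" "b x \<in> {u, Suc u}" "b y \<in> {v, Suc v}"
    unfolding adjacent_mixed_def by blast
  then have "b x < q" "b y < q" using assms by (auto simp: division_def)
  then show "p \<in> {..<q} \<times> {..<q}" using p by auto
qed

lemma adjacent_mixed_matrix:
  "adjacent_mixed n (\<lambda>x y. ordered_matrix Es vs $$ (x, y)) b = adjacent_mixed n M b"
proof -
  have "ordered_matrix Es vs $$ (x, y) = M x y" if "x < n" "y < n" for x y
    using that by (simp add: ordered_matrix_def entry_def n_def)
  then have "corner (\<lambda>x y. ordered_matrix Es vs $$ (x, y)) x y \<longleftrightarrow> corner M x y"
    if "Suc x < n" "Suc y < n" for x y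
    using that by (simp add: corner_def)
  then show ?thesis unfolding adjacent_mixed_def by blast
qed

text \<open>Averaging over the lines of \<open>adjacent_mixed\<close>: it has at most
  \<open>c * q\<close> ones, so one of the \<open>q - 1\<close> candidate pairs sees few
  corners.\<close>

lemma mixed_free_mergeable:
  assumes "mixed_free k (ordered_matrix Es vs)" "k \<ge> 1" "division n b q" "q \<ge> 2"
  obtains i where "Suc i < q" "card (joined_items b i) \<le> 64 * k * 4096 ^ k"
proof -
  \<comment> \<open>The constant of \<open>marcus_tardos\<close> for a grid minor of size
    \<open>2 * k\<close>.\<close>
  define c where "c = 16 * k * 4096 ^ k"
  define A where "A = adjacent_mixed n M b"
  obtain m where m: "2 * k = Suc m" using assms(2) by (cases "2 * k") auto
  have dims: "dim_row (ordered_matrix Es vs) = n" "dim_col (ordered_matrix Es vs) = n"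
    by (simp_all add: ordered_matrix_def n_def)
  have "\<not> grid_minor (2 * k) A"
    using mixed_minor_from_grid[OF dims assms(2) division_mono[OF assms(3)]] assms(1)
    unfolding adjacent_mixed_matrix A_def by blast
  then have "card A \<le> 8 * (2 * k) * 64 ^ (2 * k) * q"
    using marcus_tardos[OF adjacent_mixed_subset[OF assms(3)]] unfolding m A_def by blast
  also have "8 * (2 * k) * 64 ^ (2 * k) = c" by (simp add: c_def power_mult)
  finally have upper: "card A \<le> c * q" .
  have finA: "finite A"
    using adjacent_mixed_subset[OF assms(3)] unfolding A_def by (rule finite_subset) simp
  have "\<exists>i. Suc i < q \<and> card (joined_items b i) \<le> 4 * c"
  proof (rule ccontr)
    assume "\<not> ?thesis"
    then have big: "Suc (4 * c) \<le> card (joined_items b i)" if "i < q - 1" for i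
      using that by (metis less_diff_conv Suc_eq_plus1 not_less_eq_eq)
    have "(q - 1) * Suc (4 * c) = (\<Sum>i<q - 1. Suc (4 * c))" by simp
    also have "\<dots> \<le> (\<Sum>i<q - 1. 2 * card (A `` {i}))"
    proof (rule sum_mono)
      fix i assume "i \<in> {..<q - 1}"
      then show "Suc (4 * c) \<le> 2 * card (A `` {i})"
        using big[of i] card_joined_items_le[OF assms(3), of i] unfolding A_def by simp
    qed
    also have "\<dots> = 2 * card (SIGMA i:{..<q - 1}. A `` {i})"
      using finA by (subst card_SigmaI) (auto simp: sum_distrib_left intro: finite_subset[of _ "snd ` A"] rev_image_eqI)
    also have "\<dots> \<le> 2 * card A"
      using finA by (intro mult_le_mono2 card_mono) auto
    finally have "(q - 1) * Suc (4 * c) \<le> 2 * (c * q)" using upper by simp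
    \<comment> \<open>From \<open>q \<ge> 2\<close> follows \<open>q \<le> 2 * (q - 1)\<close>, so
      the right-hand side is at most \<open>(q - 1) * (4 * c)\<close>.\<close>
    moreover obtain q' where "q = Suc (Suc q')" using assms(4) by (metis add_2_eq_Suc le_Suc_ex)
    ultimately show False by (simp add: algebra_simps)
  qed
  then show thesis using that by (auto simp: c_def)
qed

text \<open>Induction on the number of parts: while two or more remain, perform the merge given by
  \<open>mixed_free_mergeable\<close>, which preserves the bound \<open>T\<close>, and pass from the
  old blocks to the new ones.\<close>

lemma bounded_merges_to_whole:
  assumes free: "mixed_free k (ordered_matrix Es vs)" "k \<ge> 1" and "n > 0"
    and "division n b q" "\<And>i. card (mixed_items b i) \<le> T" and T: "T = 64 * k * 4096 ^ k"
  shows "(bounded_merge D Es (T * (2 * (4 ^ length Es) ^ Suc T)))\<^sup>*\<^sup>* (blocks b) {D}"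
  using assms(4,5)
proof (induction q arbitrary: b)
  case 0
  then show ?case using \<open>n > 0\<close> by (auto simp: division_def)
next
  case (Suc q)
  define N :: nat where "N = (4 ^ length Es) ^ Suc T"
  have "T \<ge> 1" using T free(2) by simp
  then have N_le: "N \<le> T * (2 * N)" by simp
  have N: "card {X \<in> blocks b. X \<subseteq> region b i} \<le> N" for i
    unfolding N_def by (rule card_blocks_region_le[OF Suc.prems(1) Suc.prems(2)])
  show ?case
  proof (cases "q = 0")
    case True
    have D_ne: "D \<noteq> {}" using \<open>n > 0\<close> by (auto simp: D_eq)
    have part_D: "partition_on D {D}" using D_ne by (simp add: partition_on_space)
    \<comment> \<open>A single part has at most \<open>N\<close> blocks, which may be merged in any
      order, as an error degree never exceeds the number of parts.\<close>
    have "region b 0 = D"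
      using Suc.prems(1) True by (auto simp: region_def D_eq division_def)
    moreover have "X \<subseteq> D" if "X \<in> blocks b" for X
      using that partition_onD1[OF partition_blocks[of b]] by blast
    ultimately have "{X \<in> blocks b. X \<subseteq> region b 0} = blocks b" by auto
    then have "card (blocks b) \<le> N" using N[of 0] by simp
    have "refines D (blocks b) {D}"
      unfolding refines_def using part_D partition_blocks[of b] by (auto dest: partition_onD1)
    then show ?thesis
    proof (rule bounded_merge_chain[OF _ finite_D])
      fix Q X assume Q: "refines D (blocks b) Q"
      have fin: "finite (blocks b)" by (simp add: blocks_def)
      have "finite Q" using Q finite_elements[OF finite_D] by (auto simp: refines_def)
      then have "error_degree Es Q X \<le> card Q"
        unfolding error_degree_def by (intro card_mono) auto
      also have "\<dots> \<le> card (blocks b)" using card_parts_within_le[OF Q fin, of UNIV] by simp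
      finally show "error_degree Es Q X \<le> T * (2 * (4 ^ length Es) ^ Suc T)"
        using \<open>card (blocks b) \<le> N\<close> N_le unfolding N_def by linarith
    qed
  next
    case False
    then obtain i where i: "Suc i < Suc q" "card (joined_items b i) \<le> T"
      using mixed_free_mergeable[OF free Suc.prems(1)] unfolding T by auto
    let ?b = "merge_at i \<circ> b"
    have items: "card (mixed_items ?b j) \<le> T" for j
      by (rule card_mixed_items_merge_le[OF Suc.prems(2) i(2)])
    \<comment> \<open>Between the two block partitions, a region of \<open>?b\<close> holds at most
      \<open>2 * N\<close> old blocks and a part is mixed with at most \<open>T\<close>
      regions.\<close>
    have "(bounded_merge D Es (T * (2 * (4 ^ length Es) ^ Suc T)))\<^sup>*\<^sup>* (blocks b) (blocks ?b)"
      by (rule bounded_merge_chain[OF refines_blocks_compose finite_D])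
        (use error_degree_between_le card_blocks_merged_region_le[OF N] items in \<open>unfold N_def, blast\<close>)
    moreover have "division n ?b q" using division_merge[OF Suc.prems(1) i(1)] by simp
    ultimately show ?thesis using Suc.IH[of ?b] items by (meson rtranclp_trans)
  qed
qed

lemma twin_width_bound:
  assumes "mixed_free k (ordered_matrix Es vs)" "k \<ge> 1" and T: "T = 64 * k * 4096 ^ k"
  shows "twin_width D Es \<le> T * (2 * (4 ^ length Es) ^ Suc T)"
proof (cases "n > 0")
  case True
  let ?d = "T * (2 * (4 ^ length Es) ^ Suc T)"
  \<comment> \<open>A part with one index contains no two consecutive rows, hence no corner.\<close>
  have items: "mixed_items id i = {}" for i by (auto simp: mixed_items_def)
  have "key id x = key id x' \<longleftrightarrow> x = x'" for x x' by (auto simp: key_eq_iff)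
  then have "block id x = {vs ! x}" if "x < n" for x
    using that unfolding block_def by auto
  then have "blocks id = (\<lambda>v. {v}) ` D"
    unfolding blocks_def D_eq image_image by (intro image_cong) auto
  moreover have "division n id n" by (simp add: division_def)
  ultimately have chain: "(bounded_merge D Es ?d)\<^sup>*\<^sup>* ((\<lambda>v. {v}) ` D) {D}"
    using bounded_merges_to_whole[OF assms(1,2) True, of id n T] items T by simp
  have D_ne: "D \<noteq> {}" using True by (auto simp: D_eq)
  have "{Y \<in> {D}. Y \<noteq> D \<and> \<not> homogeneous Es D Y} = {}" by blast
  then have "error_degree Es {D} D = 0"
    by (simp only: error_degree_def card.empty)
  then have "bounded_partition D Es ?d {D}"
    using D_ne by (simp add: bounded_partition_def partition_on_space)
  moreover have "{D} - {{}} = {D}" using D_ne by blast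
  ultimately show ?thesis using chain by (intro twin_width_leI) simp_all
next
  case False
  then have "D = {}" by (simp add: D_eq)
  then show ?thesis
    by (intro twin_width_leI) (auto simp: bounded_partition_def partition_on_def)
qed

end

section \<open>The double exponential bound\<close>

lemma bound_le_double_exponential:
  assumes "k \<ge> 1"
  shows "(64 * k * 4096 ^ k) * (2 * (4 ^ h) ^ Suc (64 * k * 4096 ^ k)) \<le> (2::nat) ^ 2 ^ ((20 + 2 * h + 1) * k)"
proof -
  define T where "T = 64 * k * 4096 ^ k"
  \<comment> \<open>From \<open>64 \<le> 64 ^ k\<close>, \<open>k \<le> 2 ^ k\<close> and
    \<open>64 * 2 * 4096 = 2 ^ 19\<close>.\<close>
  have "T \<le> 2 ^ (19 * k)"
  proof -
    have "(64::nat) \<le> 64 ^ k" using assms by (simp add: self_le_power)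
    moreover have "k \<le> 2 ^ k" by (simp add: less_imp_le)
    ultimately have "T \<le> 64 ^ k * 2 ^ k * 4096 ^ k" unfolding T_def by (intro mult_le_mono) auto
    also have "\<dots> = (64 * 2 * 4096) ^ k" by (simp only: power_mult_distrib)
    also have "\<dots> = 2 ^ (19 * k)" by (simp add: power_mult)
    finally show ?thesis .
  qed
  then have "Suc T \<le> 2 * 2 ^ (19 * k)" using one_le_power[of "2::nat" "19 * k"] by linarith
  also have "\<dots> = 2 ^ Suc (19 * k)" by simp
  also have "\<dots> \<le> 2 ^ (20 * k)" using assms by (intro power_increasing) auto
  finally have T: "Suc T \<le> 2 ^ (20 * k)" .
  have "2 * h + 1 \<le> 2 ^ (2 * h + 1)" by (rule less_imp_le[OF less_exp])
  also have "\<dots> \<le> 2 ^ ((2 * h + 1) * k)"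
    using mult_le_mono2[OF assms, of "2 * h + 1"] by (intro power_increasing) simp_all
  finally have h: "2 * h + 1 \<le> 2 ^ ((2 * h + 1) * k)" .
  have four: "(4::nat) ^ h = 2 ^ (2 * h)" by (simp add: power_mult)
  \<comment> \<open>Bounding the factor \<open>T\<close> by \<open>2 ^ T\<close> makes everything a
    power of 2 with exponent \<open>Suc T * (2 * h + 1)\<close>, whose two factors are bounded
    separately.\<close>
  have "T * (2 * (4 ^ h) ^ Suc T) \<le> 2 ^ T * (2 * (4 ^ h) ^ Suc T)"
    by (intro mult_le_mono1 less_imp_le less_exp)
  also have "\<dots> = 2 ^ (T + (1 + 2 * h * Suc T))"
    by (simp only: four power_add power_mult power_one_right)
  also have "T + (1 + 2 * h * Suc T) = Suc T * (2 * h + 1)" by (simp add: algebra_simps)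
  also have "(2::nat) ^ (Suc T * (2 * h + 1)) \<le> 2 ^ (2 ^ (20 * k) * 2 ^ ((2 * h + 1) * k))"
    by (intro power_increasing mult_le_mono T h) simp
  also have "2 ^ (20 * k) * 2 ^ ((2 * h + 1) * k) = (2::nat) ^ ((20 + 2 * h + 1) * k)"
    by (simp only: power_add[symmetric] add_mult_distrib add.assoc)
  finally show ?thesis unfolding T_def .
qed

text \<open>The hidden constant depends on the number \<open>h\<close> of relations, as an entry
  takes up to \<open>4 ^ h\<close> values, but neither on the structure nor on the ordering.\<close>

theorem theorem5p8:
  fixes h :: nat
  shows "\<exists>f :: nat \<Rightarrow> nat. (\<lambda>k. real (f k)) \<in> O(\<lambda>k. real k) \<and>
    (\<forall>k\<ge>1. \<forall>(D :: 'a set) (Es :: 'a rel list).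
       binary_structure D Es \<and> length Es = h \<and>
       (\<exists>vs. domain_ordering D vs \<and> mixed_free k (ordered_matrix Es vs))
       \<longrightarrow> twin_width D Es \<le> 2 ^ (2 ^ f k))"
proof (intro exI[of _ "\<lambda>k. (20 + 2 * h + 1) * k"] conjI allI impI)
  show "(\<lambda>k. real ((20 + 2 * h + 1) * k)) \<in> O(\<lambda>k. real k)"
    by (rule bigoI[of _ "real (20 + 2 * h + 1)"]) (simp add: algebra_simps)
next
  fix k :: nat and D :: "'a set" and Es :: "'a rel list"
  assume "k \<ge> 1" and *: "binary_structure D Es \<and> length Es = h \<and>
       (\<exists>vs. domain_ordering D vs \<and> mixed_free k (ordered_matrix Es vs))"
  then obtain vs where vs: "domain_ordering D vs" "mixed_free k (ordered_matrix Es vs)" by blast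
  interpret ordered_structure D Es vs "length vs" by (unfold ordered_structure_def) (simp_all add: vs(1))
  show "twin_width D Es \<le> 2 ^ 2 ^ ((20 + 2 * h + 1) * k)"
    using twin_width_bound[OF vs(2) \<open>k \<ge> 1\<close> refl] bound_le_double_exponential[OF \<open>k \<ge> 1\<close>, of h] *
    by (auto intro: order_trans)
qed

end
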